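(* Let $G$ be a connected 4-regular graph. Let $v$ and $w$ be adjacent vertices of $G$ such that they share exactly one common neighbour. Then \[ c_2^{(2)}(G - v) = c_2^{(2)}(G - w). \]
   Context: For a finite graph $H$ (multiple edges and self-loops allowed) attach a variable $\alpha_e$ to each edge $e$, and let $\Psi_H=\sum_{T}\prod_{e\notin T}\alpha_e$ be the Kirchhoff polynomial, the sum over all spanning trees $T$ of $H$. For a prime power $q$, $[\Psi_H]_q$ is the number of zeros of $\Psi_H$ in $\mathbb{F}_q^{|E(H)|}$; this is divisible by $q^2$ (for connected $H$ with at least three vertices, by a result of Schnetz), and $c_2^{(q)}(H)\in\mathbb{Z}/q\mathbb{Z}$ is the residue of $[\Psi_H]_q/q^2$ modulo $q$. $G-v$ is $G$ with vertex $v$ and its incident edges deleted. "Share exactly one common neighbour" means exactly one vertex other than $v,w$ is adjacent to both $v$ and $w$.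
   Formalization: G is assumed to have at least four vertices (so that both c_2 are defined), and at least five if it has a self-loop; the claim fails for some four-vertex 4-regular graphs with self-loops. *)

theory Defs
  imports "HOL-Library.Z2" "HOL-Library.FuncSet" "HOL-Library.Cardinality"
begin

section \<open>Finite multigraphs\<close>

text \<open>
  Undirected graphs with multiple edges and self-loops. An edge is a name, and \<open>ends G e\<close> is
  its set of endpoints: two vertices for an ordinary edge, one vertex for a self-loop.
\<close>

record ('v, 'e) multigraph =
  verts :: "'v set"
  edges :: "'e set"
  ends :: "'e \<Rightarrow> 'v set"

definition finite_multigraph :: "('v, 'e) multigraph \<Rightarrow> bool" where
  "finite_multigraph G \<longleftrightarrow> finite (verts G) \<and> finite (edges G) \<and>
     (\<forall>e\<in>edges G. \<exists>u\<in>verts G. \<exists>v\<in>verts G. ends G e = {u, v})"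

definition adjacent :: "('v, 'e) multigraph \<Rightarrow> 'v \<Rightarrow> 'v \<Rightarrow> bool" where
  "adjacent G u v \<longleftrightarrow> (\<exists>e\<in>edges G. ends G e = {u, v})"

definition has_loop :: "('v, 'e) multigraph \<Rightarrow> bool" where
  "has_loop G \<longleftrightarrow> (\<exists>e\<in>edges G. \<exists>v. ends G e = {v})"

text \<open>A self-loop contributes two to the degree of its vertex.\<close>

definition degree :: "('v, 'e) multigraph \<Rightarrow> 'v \<Rightarrow> nat" where
  "degree G v = card {e \<in> edges G. v \<in> ends G e} + card {e \<in> edges G. ends G e = {v}}"

definition regular :: "nat \<Rightarrow> ('v, 'e) multigraph \<Rightarrow> bool" where
  "regular k G \<longleftrightarrow> (\<forall>v\<in>verts G. degree G v = k)"

definition connected_graph :: "('v, 'e) multigraph \<Rightarrow> bool" where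
  "connected_graph G \<longleftrightarrow> verts G \<noteq> {} \<and>
     (\<forall>u\<in>verts G. \<forall>v\<in>verts G. (adjacent G)\<^sup>*\<^sup>* u v)"

definition delete_vertex :: "('v, 'e) multigraph \<Rightarrow> 'v \<Rightarrow> ('v, 'e) multigraph" where
  "delete_vertex G v =
     G\<lparr>verts := verts G - {v}, edges := {e \<in> edges G. v \<notin> ends G e}\<rparr>"

section \<open>Spanning trees and the Kirchhoff polynomial\<close>

text \<open>
  A cycle runs through distinct vertices \<open>vs\<close> along distinct edges \<open>es\<close>, the edge at position
  \<open>i\<close> joining the vertices at positions \<open>i\<close> and \<open>i + 1\<close> (cyclically). A self-loop is a cycle of
  length one, and two parallel edges form a cycle of length two.
\<close>

definition is_cycle :: "('v, 'e) multigraph \<Rightarrow> 'v list \<Rightarrow> 'e list \<Rightarrow> bool" where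
  "is_cycle G vs es \<longleftrightarrow> es \<noteq> [] \<and> length vs = length es \<and>
     distinct vs \<and> distinct es \<and> set vs \<subseteq> verts G \<and> set es \<subseteq> edges G \<and>
     (\<forall>i<length es. ends G (es ! i) = {vs ! i, vs ! (Suc i mod length vs)})"

definition is_tree :: "('v, 'e) multigraph \<Rightarrow> bool" where
  "is_tree G \<longleftrightarrow> connected_graph G \<and> (\<nexists>vs es. is_cycle G vs es)"

definition spanning_trees :: "('v, 'e) multigraph \<Rightarrow> 'e set set" where
  "spanning_trees G = {T. T \<subseteq> edges G \<and> is_tree (G\<lparr>edges := T\<rparr>)}"

text \<open>The Kirchhoff polynomial, evaluated at \<open>\<alpha>\<close>.\<close>

definition kirchhoff :: "('v, 'e) multigraph \<Rightarrow> ('e \<Rightarrow> 'k::comm_ring_1) \<Rightarrow> 'k" where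
  "kirchhoff G \<alpha> = (\<Sum>T\<in>spanning_trees G. \<Prod>e\<in>edges G - T. \<alpha> e)"

section \<open>Point counts and the \<open>c\<^sub>2\<close> invariant\<close>

text \<open>
  The finite field is passed as a type; with \<open>q\<close> its number of elements, \<open>point_count\<close> is
  the number of zeros of the Kirchhoff polynomial among the points with coordinates indexed by
  the edges.
\<close>

definition point_count :: "'k::{field, finite} itself \<Rightarrow> ('v, 'e) multigraph \<Rightarrow> nat" where
  "point_count _ G = card {\<alpha> \<in> edges G \<rightarrow>\<^sub>E (UNIV :: 'k set). kirchhoff G \<alpha> = 0}"

text \<open>
  The residue modulo \<open>q\<close> is represented by an element of \<open>{0..<q}\<close>. The value is meaningful
  when \<open>q\<^sup>2\<close> divides the point count, so that \<open>div\<close> is an exact division; this holds for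
  connected graphs with at least three vertices.
\<close>

definition c2 :: "'k::{field, finite} itself \<Rightarrow> ('v, 'e) multigraph \<Rightarrow> nat" where
  "c2 K G = (point_count K G div CARD('k)\<^sup>2) mod CARD('k)"

text \<open>The type \<^typ>\<open>bit\<close> is the field with two elements.\<close>

lemma UNIV_bit: "(UNIV :: bit set) = {0, 1}"
  by (auto intro: bit.exhaust)

instance bit :: finite
  by standard (simp add: UNIV_bit)

lemma card_bit: "CARD(bit) = 2"
  by (simp add: UNIV_bit)

end

theory Submission
  imports Defs
begin


text \<open>Over the field with two elements a spanning tree is a maximal nonvanishing minor of the incidence
  matrix, and the minors satisfy the Pluecker relations. Let \<open>c\<close> be the common neighbour and \<open>K\<close> the
  graph without \<open>v\<close> and \<open>w\<close>. In the generic case \<open>w\<close> has degree three in \<open>G - v\<close>, and expanding the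
  Kirchhoff polynomial along its edges shows that, modulo 8, its number of zeros is four times the
  number of common zeros of three polynomials of \<open>K\<close>, up to a constant. By Dodgson condensation
  and a degree count (Chevalley-Warning) the parity of the latter is that of the number of pairs
  \<open>(T, F)\<close>, where \<open>T\<close> is a spanning tree of \<open>K\<close> and its complement \<open>F\<close> a spanning 2-forest that
  separates \<open>c\<close> from one of the other two neighbours \<open>a\<close>, \<open>b\<close> of \<open>w\<close>. If \<open>p\<close>, \<open>q\<close> are the remaining
  neighbours of \<open>c\<close>, swapping the two edges at \<open>c\<close> turns this into the number of pairs of \<open>K - c\<close>
  in which \<open>F\<close> separates \<open>p\<close> from \<open>q\<close> and \<open>a\<close> from \<open>b\<close>. With the neighbours \<open>a'\<close>, \<open>b'\<close> of \<open>v\<close> in place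
  of \<open>a\<close>, \<open>b\<close> the parity is the same: the vertices of odd degree in \<open>K - c\<close> are \<open>p\<close>, \<open>q\<close>, \<open>a\<close>, \<open>b\<close>,
  \<open>a'\<close>, \<open>b'\<close>, so the sum of the two numbers counts, modulo two, the pairs separating \<open>p\<close> from \<open>q\<close>
  with weight one plus the number of edges of \<open>T\<close> that cross \<open>F\<close>, and exchanging such an edge
  between \<open>T\<close> and \<open>F\<close> shows that this sum vanishes.\<close>

text \<open>By default the simplifier rewrites \<open>+\<close> and \<open>*\<close> on \<^typ>\<open>bit\<close> into bit operations, which
  disables the ring laws.\<close>

declare add_bit_eq_xor [simp del] mult_bit_eq_and [simp del]

section \<open>Arithmetic and cancelling sums in the field with two elements\<close>

lemma bit_add_self [simp]: "a + a = 0" for a :: bit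
  by (cases a) simp_all

lemma bit_add_self_left [simp]: "a + (a + b) = b" for a b :: bit
  by (simp flip: add.assoc)

lemma bit_mult_self [simp]: "a * a = a" for a :: bit
  by (cases a) simp_all

lemma bit_eq_iff_add_eq_0: "a = b \<longleftrightarrow> a + b = 0" for a b :: bit
  by (cases a; cases b) simp_all

text \<open>A pair \<open>x\<close>, \<open>i x\<close> with distinct members contributes the same
  value twice, hence zero; fixed points contribute zero by the last hypothesis.\<close>

lemma sum_bit_involution:
  fixes g :: "'a \<Rightarrow> bit"
  assumes "finite S"
    and "\<And>x. x \<in> S \<Longrightarrow> i x \<in> S"
    and "\<And>x. x \<in> S \<Longrightarrow> i (i x) = x"
    and "\<And>x. x \<in> S \<Longrightarrow> g (i x) = g x"
    and "\<And>x. x \<in> S \<Longrightarrow> i x = x \<Longrightarrow> g x = 0"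
  shows "sum g S = 0"
  using assms
proof (induction S rule: finite_psubset_induct)
  case (psubset S)
  show ?case
  proof (cases "S = {}")
    case False
    then obtain x where x: "x \<in> S"
      by blast
    let ?S = "S - {x, i x}"
    have ix: "i x \<in> S"
      using psubset.prems(1) x .
    have "sum g ?S = 0"
    proof (rule psubset.IH)
      show "?S \<subset> S"
        using x by blast
      show "i y \<in> ?S" if "y \<in> ?S" for y
        using that psubset.prems(1,2) x by (metis Diff_iff insertCI insertE singletonD)
    qed (use psubset.prems in auto)
    moreover have "sum g S = sum g ?S + sum g {x, i x}"
      using psubset.hyps x ix by (subst sum.subset_diff[of "{x, i x}" S]) auto
    moreover have "sum g {x, i x} = 0"
      using psubset.prems(3,4)[OF x] by (cases "i x = x") auto
    ultimately show ?thesis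
      by simp
  qed simp
qed

lemma sum_bit_off_diagonal:
  fixes h :: "'a \<Rightarrow> 'a \<Rightarrow> bit"
  assumes "finite S" and "\<And>x y. x \<in> S \<Longrightarrow> y \<in> S \<Longrightarrow> h x y = h y x"
  shows "(\<Sum>x\<in>S. \<Sum>y\<in>S - {x}. h x y) = 0"
proof -
  have "(\<Sum>x\<in>S. \<Sum>y\<in>S - {x}. h x y) = (\<Sum>(x, y)\<in>(SIGMA x:S. S - {x}). h x y)"
    using assms(1) by (subst sum.Sigma) auto
  also have "\<dots> = 0"
    by (rule sum_bit_involution[where i = "\<lambda>(x, y). (y, x)"]) (use assms in auto)
  finally show ?thesis .
qed

section \<open>Permanents modulo two\<close>

text \<open>Modulo two the permanent is the determinant, so no order on rows and columns is needed.\<close>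

definition perm2 :: "('c \<Rightarrow> 'r \<Rightarrow> bit) \<Rightarrow> 'c set \<Rightarrow> 'r set \<Rightarrow> bit" where
  "perm2 A S U = (\<Sum>f | f \<in> S \<rightarrow>\<^sub>E U \<and> bij_betw f S U. \<Prod>e\<in>S. A e (f e))"

lemma perm2_empty:
  fixes A :: "'c \<Rightarrow> 'r \<Rightarrow> bit"
  shows "perm2 A {} U = of_bool (U = {})"
proof (cases "U = {}")
  case True
  then have "{f. f \<in> ({} :: 'c set) \<rightarrow>\<^sub>E U \<and> bij_betw f {} U} = {\<lambda>_. undefined}"
    by (auto simp: bij_betw_def)
  then have "perm2 A {} U = (\<Sum>f\<in>{\<lambda>_. undefined}. \<Prod>e\<in>{}. A e (f e))"
    by (simp only: perm2_def)
  then show ?thesis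
    using True by simp
qed (auto simp: perm2_def bij_betw_def)

lemma perm2_card_neq: "finite S \<Longrightarrow> card S \<noteq> card U \<Longrightarrow> perm2 A S U = 0"
  unfolding perm2_def by (rule sum.neutral) (auto dest: bij_betw_same_card)

text \<open>Laplace expansion along the column \<open>e\<close>: the bijections are sorted by the
  row \<open>j\<close> that they assign to \<open>e\<close>.\<close>

lemma perm2_column:
  assumes "finite S" and "finite U" and "e \<notin> S"
  shows "perm2 A (insert e S) U = (\<Sum>j\<in>U. A e j * perm2 A S (U - {j}))"
proof -
  let ?B = "\<lambda>S U. {f. f \<in> S \<rightarrow>\<^sub>E U \<and> bij_betw f S U}"
  have fin: "finite (?B S U)" if "finite S" "finite U" for S :: "'a set" and U :: "'b set"
    using that by (simp add: finite_PiE)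
  have "(\<Sum>j\<in>U. A e j * perm2 A S (U - {j})) =
      (\<Sum>(j, f)\<in>(SIGMA j:U. ?B S (U - {j})). A e j * (\<Prod>d\<in>S. A d (f d)))"
    unfolding perm2_def sum_distrib_left
    by (rule sum.Sigma) (use assms fin in auto)
  also have "\<dots> = perm2 A (insert e S) U"
    unfolding perm2_def
  proof (rule sum.reindex_bij_witness[where
        i = "\<lambda>f. (f e, restrict f S)" and j = "\<lambda>(j, f). f(e := j)"])
    fix p assume "p \<in> (SIGMA j:U. ?B S (U - {j}))"
    then obtain j f where p: "p = (j, f)" "j \<in> U" and f: "f \<in> S \<rightarrow>\<^sub>E U - {j}" "bij_betw f S (U - {j})"
      by auto
    have "restrict f S = f"
      using f(1) by (auto simp: PiE_iff extensional_restrict)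
    moreover have "restrict (f(e := j)) S = restrict f S"
      using assms(3) by (auto simp: restrict_def)
    ultimately show "((case p of (j, f) \<Rightarrow> f(e := j)) e, restrict (case p of (j, f) \<Rightarrow> f(e := j)) S) = p"
      using p by simp
    have "bij_betw (f(e := j)) S (U - {j})"
      using f(2) assms(3) by (subst bij_betw_cong[of _ _ f]) auto
    then have "bij_betw (f(e := j)) (S \<union> {e}) (U - {j} \<union> {j})"
      using notIn_Un_bij_betw[of e S "f(e := j)" "U - {j}"] assms(3) by simp
    then show "(case p of (j, f) \<Rightarrow> f(e := j)) \<in> ?B (insert e S) U"
      using p f(1) assms(3) by (auto simp: PiE_iff extensional_def insert_absorb)
    show "(\<Prod>d\<in>insert e S. A d ((case p of (j, f) \<Rightarrow> f(e := j)) d)) =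
        (case p of (j, f) \<Rightarrow> A e j * (\<Prod>d\<in>S. A d (f d)))"
      using p assms(1,3) by (auto intro!: arg_cong2[of _ _ _ _ "(*)"] prod.cong)
  next
    fix f assume "f \<in> ?B (insert e S) U"
    then have f: "f \<in> insert e S \<rightarrow>\<^sub>E U" "bij_betw f (insert e S) U"
      by auto
    show "(case (f e, restrict f S) of (j, g) \<Rightarrow> g(e := j)) = f"
      using f(1) assms(3) by (auto simp: fun_eq_iff PiE_iff extensional_def)
    have "bij_betw f S (U - {f e})"
      using bij_betw_DiffI[OF f(2), of "{e}" "{f e}"] f(1) assms(3) by (auto simp: PiE_iff bij_betw_def)
    then have b: "bij_betw (restrict f S) S (U - {f e})"
      by (subst bij_betw_cong[of _ _ f]) auto
    then have "restrict f S \<in> S \<rightarrow>\<^sub>E U - {f e}"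
      by (auto simp: PiE_iff bij_betw_def)
    then show "(f e, restrict f S) \<in> (SIGMA j:U. ?B S (U - {j}))"
      using f(1) b by auto
  qed
  finally show ?thesis
    by simp
qed

text \<open>Laplace expansion along the row \<open>i\<close>, by induction on the columns: expansion
  along the new column \<open>d\<close> and expansion along \<open>i\<close> give the same double
  sum in either order.\<close>

lemma perm2_row:
  assumes "finite S" and "finite U" and "i \<notin> U"
  shows "perm2 A S (insert i U) = (\<Sum>e\<in>S. A e i * perm2 A (S - {e}) U)"
  using assms
proof (induction S arbitrary: U)
  case empty
  then show ?case
    by (simp add: perm2_empty)
next
  case (insert d S)
  have "perm2 A (insert d S) (insert i U) =
      A d i * perm2 A S U + (\<Sum>j\<in>U. A d j * perm2 A S (insert i (U - {j})))"
  proof -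
    have "insert i U - {j} = insert i (U - {j})" if "j \<in> U" for j
      using that insert.prems by auto
    then show ?thesis
      using insert by (subst perm2_column) (auto intro!: sum.cong)
  qed
  also have "(\<Sum>j\<in>U. A d j * perm2 A S (insert i (U - {j}))) =
      (\<Sum>j\<in>U. \<Sum>e\<in>S. A d j * A e i * perm2 A (S - {e}) (U - {j}))"
    using insert by (intro sum.cong) (auto simp: sum_distrib_left mult.assoc)
  also have "\<dots> = (\<Sum>e\<in>S. A e i * (\<Sum>j\<in>U. A d j * perm2 A (S - {e}) (U - {j})))"
    by (subst sum.swap) (simp add: sum_distrib_left ac_simps)
  also have "\<dots> = (\<Sum>e\<in>S. A e i * perm2 A (insert d S - {e}) U)"
  proof (rule sum.cong)
    fix e assume e: "e \<in> S"
    then have "insert d S - {e} = insert d (S - {e})"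
      using insert.hyps by auto
    then show "A e i * (\<Sum>j\<in>U. A d j * perm2 A (S - {e}) (U - {j})) =
        A e i * perm2 A (insert d S - {e}) U"
      using insert e by (simp add: perm2_column)
  qed simp
  finally show ?case
    using insert.hyps by simp
qed

text \<open>The sum is the minor of \<open>S\<close> with the column \<open>e\<close> repeated. A
  second expansion along \<open>e\<close> gives a symmetric sum over ordered pairs of distinct rows,
  whose terms cancel.\<close>

lemma perm2_repeated_column:
  assumes "finite S" and "finite U" and "e \<in> S"
  shows "(\<Sum>j\<in>U. A e j * perm2 A S (U - {j})) = 0"
proof -
  have "perm2 A S (U - {j}) = (\<Sum>k\<in>U - {j}. A e k * perm2 A (S - {e}) (U - {j} - {k}))" for j
    using perm2_column[of "S - {e}" "U - {j}" e A] assms by (simp add: insert_absorb)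
  then have "(\<Sum>j\<in>U. A e j * perm2 A S (U - {j})) =
      (\<Sum>j\<in>U. \<Sum>k\<in>U - {j}. A e j * A e k * perm2 A (S - {e}) (U - {j} - {k}))"
    by (simp add: sum_distrib_left mult.assoc)
  also have "\<dots> = 0"
    using assms(2) by (rule sum_bit_off_diagonal) (simp add: ac_simps Diff_insert2[symmetric] insert_commute)
  finally show ?thesis .
qed

lemma perm2_repeated_row:
  assumes "finite S" and "finite U" and "j \<in> U"
  shows "(\<Sum>e\<in>S. A e j * perm2 A (S - {e}) U) = 0"
proof -
  have "perm2 A (S - {e}) U = (\<Sum>d\<in>S - {e}. A d j * perm2 A (S - {e} - {d}) (U - {j}))" for e
    using perm2_row[of "S - {e}" "U - {j}" j A] assms by (simp add: insert_absorb)
  then have "(\<Sum>e\<in>S. A e j * perm2 A (S - {e}) U) =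
      (\<Sum>e\<in>S. \<Sum>d\<in>S - {e}. A e j * A d j * perm2 A (S - {e} - {d}) (U - {j}))"
    by (simp add: sum_distrib_left mult.assoc)
  also have "\<dots> = 0"
    using assms(1) by (rule sum_bit_off_diagonal) (simp add: ac_simps Diff_insert2[symmetric] insert_commute)
  finally show ?thesis .
qed

text \<open>Once the sums are interchanged, the sum over \<open>e\<close> is, for each row
  \<open>j\<close>, the minor of \<open>X\<close> with the row \<open>j\<close> repeated, which
  vanishes.\<close>

lemma perm2_plucker:
  assumes "finite X" and "finite F" and "finite U"
  shows "(\<Sum>e\<in>X. perm2 A (X - {e}) U * (\<Sum>j\<in>U. A e j * perm2 A F (U - {j}))) = 0"
proof -
  have "(\<Sum>e\<in>X. perm2 A (X - {e}) U * (\<Sum>j\<in>U. A e j * perm2 A F (U - {j}))) =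
      (\<Sum>j\<in>U. perm2 A F (U - {j}) * (\<Sum>e\<in>X. A e j * perm2 A (X - {e}) U))"
    unfolding sum_distrib_left by (subst sum.swap) (simp add: ac_simps)
  also have "\<dots> = 0"
    using assms by (simp add: perm2_repeated_row)
  finally show ?thesis .
qed

text \<open>The exchange form of the Pluecker relation. Columns of \<open>F\<close> drop out, since
  adjoining them to \<open>F\<close> would repeat a column.\<close>

lemma perm2_plucker_insert:
  assumes "finite X" and "finite F" and "finite U"
  shows "(\<Sum>e\<in>X - F. perm2 A (X - {e}) U * perm2 A (insert e F) U) = 0"
proof -
  have "(\<Sum>e\<in>X - F. perm2 A (X - {e}) U * perm2 A (insert e F) U) =
      (\<Sum>e\<in>X - F. perm2 A (X - {e}) U * (\<Sum>j\<in>U. A e j * perm2 A F (U - {j})))"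
    using assms by (simp add: perm2_column)
  also have "\<dots> = (\<Sum>e\<in>X. perm2 A (X - {e}) U * (\<Sum>j\<in>U. A e j * perm2 A F (U - {j})))"
    using assms by (intro sum.mono_neutral_left) (auto simp: perm2_repeated_column)
  also have "\<dots> = 0"
    using assms by (rule perm2_plucker)
  finally show ?thesis .
qed

text \<open>Adding all other rows to the row \<open>r\<close> does not change the minor; the claim
  is the expansion along the new row.\<close>

lemma perm2_row_sum:
  assumes "finite S" and "finite U" and "r \<notin> U"
  shows "perm2 A S (insert r U) = (\<Sum>e\<in>S. (\<Sum>j\<in>insert r U. A e j) * perm2 A (S - {e}) U)"
proof -
  have "(\<Sum>e\<in>S. (\<Sum>j\<in>U. A e j) * perm2 A (S - {e}) U) =
      (\<Sum>j\<in>U. \<Sum>e\<in>S. A e j * perm2 A (S - {e}) U)"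
    unfolding sum_distrib_right by (rule sum.swap)
  also have "\<dots> = 0"
    using assms by (simp add: perm2_repeated_row)
  finally show ?thesis
    using assms by (simp add: perm2_row distrib_right sum.distrib)
qed


lemma perm2_image:
  assumes "finite S" and "finite U" and "inj_on h S"
  shows "perm2 A (h ` S) U = perm2 (\<lambda>e. A (h e)) S U"
  using assms
proof (induction S arbitrary: U)
  case (insert e S)
  then have "h e \<notin> h ` S"
    by auto
  then show ?case
    using insert by (auto simp: perm2_column intro!: sum.cong)
qed (simp add: perm2_empty)

lemma perm2_desnanot_jacobi:
  assumes fin: "finite S" "finite U"
    and cd: "c \<noteq> d" "c \<notin> S" "d \<notin> S"
    and rt: "r \<noteq> t" "r \<notin> U" "t \<notin> U"
  shows "perm2 A (insert c (insert d S)) (insert r (insert t U)) * perm2 A S U =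
    perm2 A (insert d S) (insert t U) * perm2 A (insert c S) (insert r U) +
    perm2 A (insert d S) (insert r U) * perm2 A (insert c S) (insert t U)"
proof -
  \<comment> \<open>The Pluecker relation for the columns of \<open>A\<close> together with two unit columns.\<close>
  define B where "B = case_sum A (\<lambda>i j. of_bool (j = i))"
  let ?U = "insert r (insert t U)"
  have col: "perm2 B (Inl ` S) U = perm2 A S U" if "finite S" "finite U" for S U
    using that by (simp add: perm2_image B_def)
  have unit: "perm2 B (insert (Inr i) X) U = perm2 B X (U - {i})"
    if "finite X" "finite U" "Inr i \<notin> X" "i \<in> U" for i X U
  proof -
    have "perm2 B (insert (Inr i) X) U = (\<Sum>j\<in>U. if j = i then perm2 B X (U - {i}) else 0)"
      using that by (subst perm2_column) (auto simp: B_def intro!: sum.cong)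
    then show ?thesis
      using that by simp
  qed
  \<comment> \<open>Only \<open>Inr r\<close>, \<open>Inl c\<close> and \<open>Inl d\<close> lie in
    \<open>?X\<close> and not in \<open>?F\<close>, so the relation has exactly the three products
    of the identity; a unit column strikes out its row.\<close>
  let ?X = "insert (Inr r) (Inl ` insert c (insert d S))"
  let ?F = "insert (Inr t) (Inl ` S)"
  have XF: "?X - ?F = {Inr r, Inl c, Inl d}"
    using cd rt by auto
  have Xr: "?X - {Inr r} = Inl ` insert c (insert d S)"
    and Xc: "?X - {Inl c} = insert (Inr r) (Inl ` insert d S)"
    and Xd: "?X - {Inl d} = insert (Inr r) (Inl ` insert c S)"
    using cd by auto
  have Fc: "insert (Inl c) ?F = insert (Inr t) (Inl ` insert c S)"
    and Fd: "insert (Inl d) ?F = insert (Inr t) (Inl ` insert d S)"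
    by auto
  have Ur: "?U - {r} = insert t U" and Ut: "?U - {t} = insert r U"
    and Urt: "insert t U - {t} = U"
    using rt by auto
  have "(\<Sum>e\<in>?X - ?F. perm2 B (?X - {e}) ?U * perm2 B (insert e ?F) ?U) = 0"
    using fin by (intro perm2_plucker_insert) auto
  moreover have "perm2 B (insert (Inr r) ?F) ?U = perm2 A S U"
  proof -
    have "perm2 B (insert (Inr r) ?F) ?U = perm2 B ?F (insert t U)"
      using unit[of ?F ?U r] fin rt Ur by auto
    also have "\<dots> = perm2 B (Inl ` S) U"
      using unit[of "Inl ` S" "insert t U" t] fin Urt by auto
    finally show ?thesis
      using fin by (simp add: col)
  qed
  moreover have "perm2 B (?X - {Inr r}) ?U = perm2 A (insert c (insert d S)) ?U"
    using fin unfolding Xr by (intro col) auto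
  moreover have "perm2 B (?X - {Inl c}) ?U = perm2 A (insert d S) (insert t U)"
    using fin unfolding Xc by (subst unit) (auto simp: Ur simp del: image_insert intro!: col)
  moreover have "perm2 B (?X - {Inl d}) ?U = perm2 A (insert c S) (insert t U)"
    using fin unfolding Xd by (subst unit) (auto simp: Ur simp del: image_insert intro!: col)
  moreover have "perm2 B (insert (Inl c) ?F) ?U = perm2 A (insert c S) (insert r U)"
    using fin unfolding Fc by (subst unit) (auto simp: Ut simp del: image_insert intro!: col)
  moreover have "perm2 B (insert (Inl d) ?F) ?U = perm2 A (insert d S) (insert r U)"
    using fin unfolding Fd by (subst unit) (auto simp: Ut simp del: image_insert intro!: col)
  ultimately have "perm2 A (insert c (insert d S)) ?U * perm2 A S U +
      (perm2 A (insert d S) (insert t U) * perm2 A (insert c S) (insert r U) +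
       perm2 A (insert c S) (insert t U) * perm2 A (insert d S) (insert r U)) = 0"
    unfolding XF using cd by simp
  then show ?thesis
    by (subst bit_eq_iff_add_eq_0) (simp add: ac_simps)
qed

section \<open>Polynomials over the field with two elements\<close>

text \<open>The monomial of a set \<open>T\<close> is the product of the variables outside \<open>T\<close>.\<close>

definition cpoly :: "'e set \<Rightarrow> ('e set \<Rightarrow> bit) \<Rightarrow> ('e \<Rightarrow> bit) \<Rightarrow> bit" where
  "cpoly E h x = (\<Sum>T\<in>Pow E. h T * (\<Prod>e\<in>E - T. x e))"

lemma cpoly_cong:
  assumes "\<And>T. T \<subseteq> E \<Longrightarrow> h T = k T" and "\<And>e. e \<in> E \<Longrightarrow> x e = y e"
  shows "cpoly E h x = cpoly E k y"
  unfolding cpoly_def using assms by (auto intro!: sum.cong prod.cong arg_cong2[of _ _ _ _ "(*)"])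

lemma cpoly_empty [simp]: "cpoly {} h x = h {}"
  by (simp add: cpoly_def)

lemma cpoly_zero [simp]: "cpoly E (\<lambda>T. 0) x = 0"
  by (simp add: cpoly_def)

lemma cpoly_add: "cpoly E (\<lambda>T. h T + k T) x = cpoly E h x + cpoly E k x"
  by (simp add: cpoly_def distrib_right sum.distrib)

lemma cpoly_scale: "cpoly E (\<lambda>T. a * h T) x = a * cpoly E h x"
  by (simp add: cpoly_def sum_distrib_left mult.assoc)

lemma cpoly_sum: "cpoly E (\<lambda>T. \<Sum>i\<in>I. h i T) x = (\<Sum>i\<in>I. cpoly E (h i) x)"
  unfolding cpoly_def sum_distrib_right by (rule sum.swap)

text \<open>Deletion and contraction of \<open>e\<close>: a set without \<open>e\<close> has
  \<open>x e\<close> in its monomial, a set containing \<open>e\<close> does not.\<close>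

lemma cpoly_insert:
  assumes "finite E" and "e \<notin> E"
  shows "cpoly (insert e E) h x = x e * cpoly E h x + cpoly E (\<lambda>T. h (insert e T)) x"
proof -
  have "cpoly (insert e E) h x =
      (\<Sum>T\<in>Pow E. h T * (\<Prod>d\<in>insert e E - T. x d)) +
      (\<Sum>T\<in>insert e ` Pow E. h T * (\<Prod>d\<in>insert e E - T. x d))"
    unfolding cpoly_def Pow_insert using assms by (intro sum.union_disjoint) auto
  also have "(\<Sum>T\<in>Pow E. h T * (\<Prod>d\<in>insert e E - T. x d)) = x e * cpoly E h x"
  proof -
    have "(\<Prod>d\<in>insert e E - T. x d) = x e * (\<Prod>d\<in>E - T. x d)" if "T \<subseteq> E" for T
    proof -
      have "insert e E - T = insert e (E - T)"
        using that assms by auto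
      then show ?thesis
        using assms by simp
    qed
    then show ?thesis
      by (auto simp: cpoly_def sum_distrib_left ac_simps intro!: sum.cong)
  qed
  also have "(\<Sum>T\<in>insert e ` Pow E. h T * (\<Prod>d\<in>insert e E - T. x d)) =
      cpoly E (\<lambda>T. h (insert e T)) x"
  proof -
    have "inj_on (insert e) (Pow E)"
      by (rule inj_on_inverseI[where g = "\<lambda>T. T - {e}"]) (use assms(2) in auto)
    moreover have "insert e E - insert e T = E - T" if "T \<subseteq> E" for T
      using assms by auto
    ultimately show ?thesis
      by (auto simp: cpoly_def sum.reindex intro!: sum.cong)
  qed
  finally show ?thesis .
qed

lemma cpoly_insert_upd:
  assumes "finite E" and "e \<notin> E"
  shows "cpoly (insert e E) h (x(e := b)) = b * cpoly E h x + cpoly E (\<lambda>T. h (insert e T)) x"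
proof -
  have "cpoly E h (x(e := b)) = cpoly E h x" for h
    using assms by (intro cpoly_cong) auto
  then show ?thesis
    using assms by (simp add: cpoly_insert)
qed

subsection \<open>Sums over all points\<close>

text \<open>The product of the monomials of \<open>T\<close> and \<open>F\<close> has odd sum over
  all points exactly when every variable occurs in one of them, that is, when \<open>T\<close> and
  \<open>F\<close> are disjoint.\<close>

definition disjoint_pairs :: "'e set \<Rightarrow> ('e set \<times> 'e set) set" where
  "disjoint_pairs E = {(T, F). T \<subseteq> E \<and> F \<subseteq> E \<and> T \<inter> F = {}}"

lemma finite_disjoint_pairs [simp]: "finite E \<Longrightarrow> finite (disjoint_pairs E)"
  by (rule finite_subset[of _ "Pow E \<times> Pow E"]) (auto simp: disjoint_pairs_def)

lemma sum_disjoint_pairs_insert: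
  fixes h :: "'e set \<Rightarrow> 'e set \<Rightarrow> 'a::comm_monoid_add"
  assumes "finite E" and "e \<notin> E"
  shows "(\<Sum>(T, F)\<in>disjoint_pairs (insert e E). h T F) =
    (\<Sum>(T, F)\<in>disjoint_pairs E. h T F + h (insert e T) F + h T (insert e F))"
proof -
  let ?l = "\<lambda>(T, F). (insert e T, F)" and ?r = "\<lambda>(T, F). (T, insert e F)"
  have "disjoint_pairs (insert e E) =
      disjoint_pairs E \<union> ?l ` disjoint_pairs E \<union> ?r ` disjoint_pairs E" (is "?D = _")
  proof (intro subset_antisym subsetI)
    fix p assume "p \<in> ?D"
    then obtain T F where p: "p = (T, F)" and TF: "T \<subseteq> insert e E" "F \<subseteq> insert e E" "T \<inter> F = {}"
      by (auto simp: disjoint_pairs_def)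
    consider "e \<in> T" | "e \<in> F" | "e \<notin> T" "e \<notin> F"
      by blast
    then show "p \<in> disjoint_pairs E \<union> ?l ` disjoint_pairs E \<union> ?r ` disjoint_pairs E"
    proof cases
      case 1
      then have "p = ?l (T - {e}, F)" and "(T - {e}, F) \<in> disjoint_pairs E"
        using p TF by (auto simp: disjoint_pairs_def)
      then show ?thesis
        by blast
    next
      case 2
      then have "p = ?r (T, F - {e})" and "(T, F - {e}) \<in> disjoint_pairs E"
        using p TF by (auto simp: disjoint_pairs_def)
      then show ?thesis
        by blast
    next
      case 3
      then show ?thesis
        using p TF by (auto simp: disjoint_pairs_def)
    qed
  next
    fix p assume "p \<in> disjoint_pairs E \<union> ?l ` disjoint_pairs E \<union> ?r ` disjoint_pairs E"
    then show "p \<in> ?D"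
      using assms(2) by (auto simp: disjoint_pairs_def)
  qed
  moreover have "(disjoint_pairs E \<union> ?l ` disjoint_pairs E) \<inter> ?r ` disjoint_pairs E = {}"
    and "disjoint_pairs E \<inter> ?l ` disjoint_pairs E = {}"
    using assms(2) by (auto simp: disjoint_pairs_def)
  moreover have "inj_on ?l (disjoint_pairs E)"
    by (rule inj_on_inverseI[where g = "\<lambda>(T, F). (T - {e}, F)"])
      (use assms(2) in \<open>auto simp: disjoint_pairs_def\<close>)
  moreover have "inj_on ?r (disjoint_pairs E)"
    by (rule inj_on_inverseI[where g = "\<lambda>(T, F). (T, F - {e})"])
      (use assms(2) in \<open>auto simp: disjoint_pairs_def\<close>)
  ultimately show ?thesis
    using assms(1) by (simp add: sum.union_disjoint sum.reindex case_prod_unfold sum.distrib)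
qed

lemma sum_disjoint_pairs_swap:
  "(\<Sum>(T, F)\<in>disjoint_pairs E. h T F) = (\<Sum>(T, F)\<in>disjoint_pairs E. h F T)"
  by (rule sum.reindex_bij_witness[where i = prod.swap and j = prod.swap])
    (auto simp: disjoint_pairs_def)

text \<open>Exchanging \<open>T\<close> and \<open>F\<close> cancels the terms in pairs; the only
  disjoint pair fixed by the exchange is \<open>({}, {})\<close>.\<close>

lemma sum_disjoint_pairs_symmetric:
  fixes h :: "'e set \<Rightarrow> 'e set \<Rightarrow> bit"
  assumes "finite E" and "\<And>T F. h T F = h F T" and "h {} {} = 0"
  shows "(\<Sum>(T, F)\<in>disjoint_pairs E. h T F) = 0"
proof (rule sum_bit_involution[where i = prod.swap])
  show "(case prod.swap p of (T, F) \<Rightarrow> h T F) = (case p of (T, F) \<Rightarrow> h T F)" for p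
    by (cases p) (simp, rule assms(2))
  show "(case p of (T, F) \<Rightarrow> h T F) = 0" if "p \<in> disjoint_pairs E" "prod.swap p = p" for p
  proof -
    obtain T F where p: "p = (T, F)"
      by fastforce
    then have "F = T"
      using that(2) unfolding p swap_simp prod.inject by blast
    then have "T = {}"
      using that(1) p by (simp add: disjoint_pairs_def)
    then show ?thesis
      using assms(3) p \<open>F = T\<close> by simp
  qed
qed (use assms(1) in simp, auto simp: disjoint_pairs_def)

lemma sum_PiE_insert:
  fixes f :: "('e \<Rightarrow> bit) \<Rightarrow> 'a::comm_monoid_add"
  assumes "finite E" and "e \<notin> E"
  shows "(\<Sum>x\<in>insert e E \<rightarrow>\<^sub>E UNIV. f x) = (\<Sum>x\<in>E \<rightarrow>\<^sub>E UNIV. f (x(e := 0)) + f (x(e := 1)))"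
proof -
  have "(\<Sum>x\<in>insert e E \<rightarrow>\<^sub>E UNIV. f x) = (\<Sum>(b, x)\<in>UNIV \<times> (E \<rightarrow>\<^sub>E UNIV). f (x(e := b)))"
    unfolding PiE_insert_eq
    by (subst sum.reindex) (use inj_combinator[OF assms(2), of "\<lambda>_. UNIV"] in \<open>auto simp: case_prod_unfold\<close>)
  also have "\<dots> = (\<Sum>b\<in>UNIV. \<Sum>x\<in>E \<rightarrow>\<^sub>E UNIV. f (x(e := b)))"
    by (rule sum.cartesian_product[symmetric])
  finally show ?thesis
    by (simp add: UNIV_bit sum.distrib)
qed

text \<open>A monomial has odd sum over all points only if it contains every variable, and that is
  the monomial of the empty set. This is the degree argument of Chevalley and Warning.\<close>

lemma sum_cpoly:
  assumes "finite E"
  shows "(\<Sum>x\<in>E \<rightarrow>\<^sub>E UNIV. cpoly E h x) = h {}"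
  using assms
  by (induction E arbitrary: h) (simp_all add: sum_PiE_insert cpoly_insert_upd ac_simps)

lemma sum_cpoly_mult:
  assumes "finite E"
  shows "(\<Sum>x\<in>E \<rightarrow>\<^sub>E UNIV. cpoly E h x * cpoly E k x) = (\<Sum>(T, F)\<in>disjoint_pairs E. h T * k F)"
  using assms
proof (induction E arbitrary: h k)
  case empty
  have "disjoint_pairs {} = {({}, {} :: 'a set)}"
    by (auto simp: disjoint_pairs_def)
  then show ?case
    by simp
next
  case (insert e E)
  let ?h = "\<lambda>T. h (insert e T)" and ?k = "\<lambda>T. k (insert e T)"
  have "(\<Sum>x\<in>insert e E \<rightarrow>\<^sub>E UNIV. cpoly (insert e E) h x * cpoly (insert e E) k x) =
      (\<Sum>x\<in>E \<rightarrow>\<^sub>E UNIV. cpoly E h x * cpoly E k x + cpoly E ?h x * cpoly E k x + cpoly E h x * cpoly E ?k x)"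
    using insert.hyps by (simp add: sum_PiE_insert cpoly_insert_upd distrib_left distrib_right ac_simps)
  also have "\<dots> = (\<Sum>(T, F)\<in>disjoint_pairs (insert e E). h T * k F)"
    by (simp only: sum.distrib insert.IH sum_disjoint_pairs_insert[OF insert.hyps(1,2)])
      (simp add: sum.distrib case_prod_unfold)
  finally show ?case .
qed

section \<open>Dodgson condensation\<close>

text \<open>The symmetric block matrix formed by the diagonal matrix of the variables,
  \<open>A\<close>, its transpose and a zero block. For a reduced incidence matrix its determinant
  is the Kirchhoff polynomial modulo two.\<close>

fun bordered :: "('e \<Rightarrow> 'v \<Rightarrow> bit) \<Rightarrow> ('e \<Rightarrow> bit) \<Rightarrow> 'e + 'v \<Rightarrow> 'e + 'v \<Rightarrow> bit" where
  "bordered A x (Inl e) (Inl d) = (if e = d then x e else 0)"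
| "bordered A x (Inl e) (Inr j) = A e j"
| "bordered A x (Inr j) (Inl e) = A e j"
| "bordered A x (Inr j) (Inr k) = 0"

text \<open>Expansion along the column \<open>Inl e\<close> and then along the row
  \<open>Inl d\<close>. The two indices may differ, because condensation also involves off-diagonal
  minors.\<close>

lemma perm2_bordered_insert:
  assumes "finite E" and "finite R1" and "finite R2" and "e \<notin> E" and "d \<notin> E"
  shows "perm2 (bordered A x) (Inl ` insert e E \<union> Inr ` R1) (Inl ` insert d E \<union> Inr ` R2) =
    of_bool (e = d) * x e * perm2 (bordered A x) (Inl ` E \<union> Inr ` R1) (Inl ` E \<union> Inr ` R2) +
    (\<Sum>k\<in>R2. A e k * (\<Sum>j\<in>R1. A d j *
      perm2 (bordered A x) (Inl ` E \<union> Inr ` (R1 - {j})) (Inl ` E \<union> Inr ` (R2 - {k}))))"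
proof -
  let ?M = "bordered A x" and ?S = "Inl ` E \<union> Inr ` R1" and ?U = "Inl ` E \<union> Inr ` R2"
  let ?U' = "insert (Inl d) ?U"
  have "perm2 ?M (insert (Inl e) ?S) ?U' = (\<Sum>i\<in>?U'. ?M (Inl e) i * perm2 ?M ?S (?U' - {i}))"
    using assms by (intro perm2_column) auto
  also have "\<dots> = ?M (Inl e) (Inl d) * perm2 ?M ?S (?U' - {Inl d}) +
      (\<Sum>i\<in>?U. ?M (Inl e) i * perm2 ?M ?S (?U' - {i}))"
    using assms by (intro sum.insert) auto
  also have "?U' - {Inl d} = ?U"
    using assms by auto
  also have "(\<Sum>i\<in>?U. ?M (Inl e) i * perm2 ?M ?S (?U' - {i})) =
      (\<Sum>i\<in>Inr ` R2. ?M (Inl e) i * perm2 ?M ?S (?U' - {i}))"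
    using assms by (intro sum.mono_neutral_right) auto
  also have "\<dots> = (\<Sum>k\<in>R2. A e k * perm2 ?M ?S (?U' - {Inr k}))"
    by (subst sum.reindex) auto
  also have "\<dots> = (\<Sum>k\<in>R2. A e k * (\<Sum>j\<in>R1. A d j *
      perm2 ?M (Inl ` E \<union> Inr ` (R1 - {j})) (Inl ` E \<union> Inr ` (R2 - {k}))))"
  proof (rule sum.cong)
    fix k assume "k \<in> R2"
    let ?V = "Inl ` E \<union> Inr ` (R2 - {k})"
    have "?U' - {Inr k} = insert (Inl d) ?V"
      by auto
    then have "perm2 ?M ?S (?U' - {Inr k}) = (\<Sum>c\<in>?S. ?M c (Inl d) * perm2 ?M (?S - {c}) ?V)"
      using assms by (auto intro!: perm2_row)
    also have "\<dots> = (\<Sum>c\<in>Inr ` R1. ?M c (Inl d) * perm2 ?M (?S - {c}) ?V)"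
      using assms by (intro sum.mono_neutral_right) auto
    also have "\<dots> = (\<Sum>j\<in>R1. A d j * perm2 ?M (?S - {Inr j}) ?V)"
      by (subst sum.reindex) auto
    also have "\<dots> = (\<Sum>j\<in>R1. A d j * perm2 ?M (Inl ` E \<union> Inr ` (R1 - {j})) ?V)"
      by (intro sum.cong arg_cong2[of _ _ _ _ "(*)"] arg_cong2[of _ _ _ _ "perm2 ?M"]) auto
    finally show "A e k * perm2 ?M ?S (?U' - {Inr k}) = A e k * (\<Sum>j\<in>R1. A d j *
      perm2 ?M (Inl ` E \<union> Inr ` (R1 - {j})) ?V)"
      by simp
  qed simp
  finally show ?thesis
    by simp
qed

text \<open>Expanding both minors along their new columns yields the recursion satisfied by the
  minors of the block matrix.\<close>

lemma cpoly_perm2_insert_mult: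
  assumes "finite E" and "finite R1" and "finite R2" and "e \<notin> E" and "d \<notin> E"
  shows "cpoly E (\<lambda>T. perm2 A (insert d T) R1 * perm2 A (insert e T) R2) x =
    (\<Sum>k\<in>R2. A e k * (\<Sum>j\<in>R1. A d j * cpoly E (\<lambda>T. perm2 A T (R1 - {j}) * perm2 A T (R2 - {k})) x))"
proof -
  have "cpoly E (\<lambda>T. perm2 A (insert d T) R1 * perm2 A (insert e T) R2) x =
    cpoly E (\<lambda>T. \<Sum>k\<in>R2. A e k * (\<Sum>j\<in>R1. A d j * (perm2 A T (R1 - {j}) * perm2 A T (R2 - {k})))) x"
  proof (rule cpoly_cong)
    fix T assume "T \<subseteq> E"
    then have "finite T" "e \<notin> T" "d \<notin> T"
      using assms finite_subset by auto
    then show "perm2 A (insert d T) R1 * perm2 A (insert e T) R2 =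
      (\<Sum>k\<in>R2. A e k * (\<Sum>j\<in>R1. A d j * (perm2 A T (R1 - {j}) * perm2 A T (R2 - {k}))))"
      using assms unfolding perm2_column[OF \<open>finite T\<close> assms(2) \<open>d \<notin> T\<close>]
        perm2_column[OF \<open>finite T\<close> assms(3) \<open>e \<notin> T\<close>] sum_distrib_left[of "sum _ R1"]
      by (intro sum.cong) (simp_all add: sum_distrib_left sum_distrib_right ac_simps)
  qed simp
  then show ?thesis
    by (simp add: cpoly_sum cpoly_scale)
qed

text \<open>If \<open>T\<close> is the set of edges whose diagonal entry is not chosen, the zero
  block forces a product of a minor of \<open>A\<close> on the rows \<open>R1\<close> and one on
  \<open>R2\<close>. The row sets are independent because the induction removes a row from
  each.\<close>

lemma perm2_bordered:
  fixes A :: "'e \<Rightarrow> 'v \<Rightarrow> bit"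
  assumes "finite E" and "finite R1" and "finite R2"
  shows "perm2 (bordered A x) (Inl ` E \<union> Inr ` R1) (Inl ` E \<union> Inr ` R2) =
    cpoly E (\<lambda>T. perm2 A T R1 * perm2 A T R2) x"
  using assms
proof (induction E arbitrary: R1 R2)
  case empty
  show ?case
  proof (cases "R1 = {}")
    case False
    then obtain j where j: "j \<in> R1"
      by blast
    have "perm2 (bordered A x) (insert (Inr j) (Inr ` (R1 - {j}))) (Inr ` R2) = 0"
      using empty by (subst perm2_column) (auto intro!: sum.neutral)
    moreover have "insert (Inr j) (Inr ` (R1 - {j})) = (Inr ` R1 :: ('e + 'v) set)"
      using j by auto
    ultimately have "perm2 (bordered A x) (Inr ` R1) (Inr ` R2) = 0"
      by (simp only:)
    then show ?thesis
      using False by (simp add: perm2_empty)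
  qed (simp add: perm2_empty)
next
  case (insert e E)
  then show ?case
    by (simp add: perm2_bordered_insert[simplified] cpoly_insert cpoly_perm2_insert_mult)
qed

text \<open>The Desnanot-Jacobi identity for the block matrix. The minor without \<open>a\<close>
  and \<open>b\<close> vanishes by hypothesis, so the product of the two principal minors is the
  product of the two off-diagonal ones; these agree, and every element of the field is its own
  square.\<close>

lemma cpoly_perm2_dodgson:
  assumes "finite E" and "finite R" and "a \<notin> E" and "b \<notin> E" and "a \<noteq> b"
    and "cpoly E (\<lambda>T. perm2 A T R) x = 0"
  shows "cpoly E (\<lambda>T. perm2 A (insert a T) R) x * cpoly E (\<lambda>T. perm2 A (insert b T) R) x =
    cpoly E (\<lambda>T. perm2 A (insert a T) R * perm2 A (insert b T) R) x"
proof -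
  \<comment> \<open>With the variables of \<open>a\<close> and \<open>b\<close> set to zero, the
    diagonal entries of the two new edges vanish and only the terms with the new edge inside the set
    survive.\<close>
  define y where "y = x(a := 0, b := 0)"
  let ?S = "Inl ` E \<union> Inr ` R"
  have xy: "cpoly E h y = cpoly E h x" for h
    using assms by (intro cpoly_cong) (auto simp: y_def)
  have S: "perm2 (bordered A y) ?S ?S = 0"
    using assms by (simp add: perm2_bordered xy)
  have ins: "perm2 (bordered A y) (insert (Inl e) ?S) (insert (Inl d) ?S) =
      cpoly E (\<lambda>T. perm2 A (insert e T) R * perm2 A (insert d T) R) x"
    if "e \<in> {a, b}" "d \<in> {a, b}" for e d
  proof -
    have "y e = 0" "e \<notin> E" "d \<notin> E"
      using that assms by (auto simp: y_def)
    then have "perm2 (bordered A y) (Inl ` insert e E \<union> Inr ` R) (Inl ` insert d E \<union> Inr ` R) =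
        cpoly E (\<lambda>T. perm2 A (insert d T) R * perm2 A (insert e T) R) x"
      using assms by (subst perm2_bordered_insert)
        (simp_all add: perm2_bordered cpoly_perm2_insert_mult xy)
    then show ?thesis
      by (simp add: mult.commute)
  qed
  have "perm2 (bordered A y) (insert (Inl a) (insert (Inl b) ?S)) (insert (Inl a) (insert (Inl b) ?S)) *
      perm2 (bordered A y) ?S ?S =
      perm2 (bordered A y) (insert (Inl b) ?S) (insert (Inl b) ?S) *
      perm2 (bordered A y) (insert (Inl a) ?S) (insert (Inl a) ?S) +
      perm2 (bordered A y) (insert (Inl b) ?S) (insert (Inl a) ?S) *
      perm2 (bordered A y) (insert (Inl a) ?S) (insert (Inl b) ?S)"
    using assms by (intro perm2_desnanot_jacobi) auto
  then show ?thesis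
    unfolding S by (simp add: ins mult.commute flip: bit_eq_iff_add_eq_0)
qed


lemma finite_fst_disjoint_pairs: "finite E \<Longrightarrow> p \<in> disjoint_pairs E \<Longrightarrow> finite (fst p)"
  by (auto simp: disjoint_pairs_def intro: rev_finite_subset)

section \<open>Exchanging edges between complementary forests\<close>

text \<open>An edge outside \<open>T \<union> F\<close> joins \<open>T\<close>, and the Pluecker relation sums over its ways to leave.\<close>

lemma sum_disjoint_pairs_free_edge:
  assumes "finite E" and "finite U"
  shows "(\<Sum>(T, F)\<in>disjoint_pairs E. perm2 A T U * s F * (\<Sum>e\<in>E - T - F. perm2 A (insert e F) U)) = 0"
proof -
  have "(\<Sum>(T, F)\<in>disjoint_pairs E. perm2 A T U * s F * (\<Sum>e\<in>E - T - F. perm2 A (insert e F) U)) =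
      (\<Sum>(p, e)\<in>(SIGMA p:disjoint_pairs E. E - fst p - snd p).
        perm2 A (fst p) U * s (snd p) * perm2 A (insert e (snd p)) U)"
    using assms(1) by (subst sum.Sigma[symmetric]) (auto simp: case_prod_unfold sum_distrib_left)
  also have "\<dots> = (\<Sum>(p, e)\<in>(SIGMA p:disjoint_pairs E. fst p).
        perm2 A (fst p - {e}) U * s (snd p) * perm2 A (insert e (snd p)) U)"
    by (rule sum.reindex_bij_witness[where i = "\<lambda>((T, F), e). ((T - {e}, F), e)"
          and j = "\<lambda>((T, F), e). ((insert e T, F), e)"])
      (auto simp: disjoint_pairs_def insert_absorb)
  also have "\<dots> = (\<Sum>(T, F)\<in>disjoint_pairs E.
      s F * (\<Sum>e\<in>T. perm2 A (T - {e}) U * perm2 A (insert e F) U))"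
    using assms(1) by (subst sum.Sigma[symmetric])
      (auto simp: case_prod_unfold sum_distrib_left ac_simps intro: finite_fst_disjoint_pairs)
  also have "\<dots> = 0"
  proof (rule sum.neutral, safe)
    fix T F assume TF: "(T, F) \<in> disjoint_pairs E"
    then have "T - F = T" "finite T" "finite F"
      using assms(1) by (auto simp: disjoint_pairs_def intro: rev_finite_subset)
    then show "s F * (\<Sum>e\<in>T. perm2 A (T - {e}) U * perm2 A (insert e F) U) = 0"
      using perm2_plucker_insert[of T F U A] assms(2) by simp
  qed
  finally show ?thesis .
qed

text \<open>Replacing \<open>(T, F, t)\<close> by \<open>(insert t F, T - {t}, t)\<close> is an
  involution on the triples with \<open>t\<close> in \<open>T\<close>.\<close>

lemma sum_disjoint_pairs_move:
  assumes "finite E"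
  shows "(\<Sum>(T, F)\<in>disjoint_pairs E. \<Sum>t\<in>T. h T F t) =
    (\<Sum>(T, F)\<in>disjoint_pairs E. \<Sum>t\<in>T. h (insert t F) (T - {t}) t)"
proof -
  have fin: "finite (fst p)" if "p \<in> disjoint_pairs E" for p
    using finite_fst_disjoint_pairs[OF assms(1) that] .
  have "(\<Sum>(T, F)\<in>disjoint_pairs E. \<Sum>t\<in>T. h T F t) =
      (\<Sum>(p, t)\<in>(SIGMA p:disjoint_pairs E. fst p). h (fst p) (snd p) t)"
    using assms fin by (subst sum.Sigma[symmetric]) (auto simp: case_prod_unfold)
  also have "\<dots> = (\<Sum>(p, t)\<in>(SIGMA p:disjoint_pairs E. fst p). h (insert t (snd p)) (fst p - {t}) t)"
    by (rule sum.reindex_bij_witness[where i = "\<lambda>((T, F), t). ((insert t F, T - {t}), t)"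
          and j = "\<lambda>((T, F), t). ((insert t F, T - {t}), t)"])
      (auto simp: disjoint_pairs_def insert_absorb Diff_triv disjoint_iff)
  also have "\<dots> = (\<Sum>(T, F)\<in>disjoint_pairs E. \<Sum>t\<in>T. h (insert t F) (T - {t}) t)"
    using assms fin by (subst sum.Sigma[symmetric]) (auto simp: case_prod_unfold)
  finally show ?thesis .
qed

text \<open>By linearity the left side is the minor of \<open>F\<close> with the sum of all columns
  of \<open>E\<close> adjoined; columns of \<open>F\<close> would be repeated and drop out.\<close>

lemma sum_columns_split:
  assumes "finite E" and "finite U" and "(T, F) \<in> disjoint_pairs E"
  shows "(\<Sum>e\<in>E. \<Sum>j\<in>U. A e j * perm2 A F (U - {j})) =
    (\<Sum>t\<in>T. perm2 A (insert t F) U) + (\<Sum>e\<in>E - T - F. perm2 A (insert e F) U)"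
proof -
  have TF: "T \<subseteq> E" "F \<subseteq> E" "T \<inter> F = {}" "finite T" "finite F"
    using assms by (auto simp: disjoint_pairs_def intro: rev_finite_subset)
  have "(\<Sum>e\<in>E. \<Sum>j\<in>U. A e j * perm2 A F (U - {j})) =
      (\<Sum>e\<in>E - F. \<Sum>j\<in>U. A e j * perm2 A F (U - {j}))"
    using assms TF by (intro sum.mono_neutral_right) (auto simp: perm2_repeated_column)
  also have "\<dots> = (\<Sum>e\<in>E - F. perm2 A (insert e F) U)"
    using assms TF by (simp add: perm2_column)
  also have "E - F = T \<union> (E - T - F)"
    using TF by auto
  also have "(\<Sum>e\<in>\<dots>. perm2 A (insert e F) U) =
      (\<Sum>t\<in>T. perm2 A (insert t F) U) + (\<Sum>e\<in>E - T - F. perm2 A (insert e F) U)"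
    using assms TF by (intro sum.union_disjoint) auto
  finally show ?thesis .
qed

text \<open>Edges outside \<open>T\<close> and \<open>F\<close> contribute zero by the Pluecker
  relation. For \<open>t\<close> in \<open>T\<close> the summand is symmetric under exchanging
  \<open>T\<close> with \<open>insert t F\<close>; a fixed triple has \<open>T = {t}\<close>, too
  few columns for the rows \<open>U\<close>.\<close>

lemma sum_tree_forest_columns:
  assumes "finite E" and "finite U" and "card U \<ge> 2"
  shows "(\<Sum>(T, F)\<in>disjoint_pairs E. perm2 A T U * (\<Sum>e\<in>E. \<Sum>j\<in>U. A e j * perm2 A F (U - {j}))) = 0"
proof -
  let ?h = "\<lambda>((T, F), t). perm2 A T U * perm2 A (insert t F) U"
  define i where "i = (\<lambda>((T, F), t :: 'a). ((insert t F, T - {t}), t))"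
  have fin: "finite (fst p)" if "p \<in> disjoint_pairs E" for p
    using finite_fst_disjoint_pairs[OF assms(1) that] .
  have "(\<Sum>(T, F)\<in>disjoint_pairs E. perm2 A T U * (\<Sum>e\<in>E. \<Sum>j\<in>U. A e j * perm2 A F (U - {j}))) =
      (\<Sum>(T, F)\<in>disjoint_pairs E. perm2 A T U * (\<Sum>t\<in>T. perm2 A (insert t F) U)) +
      (\<Sum>(T, F)\<in>disjoint_pairs E. perm2 A T U * 1 * (\<Sum>e\<in>E - T - F. perm2 A (insert e F) U))"
    unfolding sum.distrib[symmetric] using assms
    by (intro sum.cong) (auto simp: sum_columns_split distrib_left)
  also have "\<dots> = (\<Sum>(T, F)\<in>disjoint_pairs E. perm2 A T U * (\<Sum>t\<in>T. perm2 A (insert t F) U))"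
    using sum_disjoint_pairs_free_edge[OF assms(1,2), of A "\<lambda>_. 1"] by simp
  also have "\<dots> = sum ?h (SIGMA p:disjoint_pairs E. fst p)"
    using assms fin by (subst sum.Sigma[symmetric]) (auto simp: case_prod_unfold sum_distrib_left)
  also have "\<dots> = 0"
  proof (rule sum_bit_involution[where i = i])
    show "finite (SIGMA p:disjoint_pairs E. fst p)"
      using assms fin by auto
    fix q assume q: "q \<in> (SIGMA p:disjoint_pairs E. fst p)"
    then obtain T F t where q_eq: "q = ((T, F), t)" "t \<in> T" and TF: "T \<subseteq> E" "F \<subseteq> E" "T \<inter> F = {}"
      by (auto simp: disjoint_pairs_def)
    have t: "t \<notin> F" "insert t (T - {t}) = T"
      using q_eq(2) TF by auto
    show "i q \<in> (SIGMA p:disjoint_pairs E. fst p)"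
      using q_eq TF by (auto simp: disjoint_pairs_def i_def)
    show "i (i q) = q" and "?h (i q) = ?h q"
      using q_eq(1) t by (simp_all add: i_def mult.commute)
    show "?h q = 0" if "i q = q"
    proof -
      have "insert t F = T" "T - {t} = F"
        using that unfolding q_eq(1) i_def by simp_all
      then have "T = {t}"
        using TF by blast
      then have "perm2 A T U = 0"
        using assms(3) by (intro perm2_card_neq) auto
      then show ?thesis
        using q_eq(1) by simp
    qed
  qed
  finally show ?thesis .
qed

text \<open>Moving an edge \<open>t\<close> from the tree \<open>T\<close> to the forest \<open>F\<close> exchanges their roles; the edges of the
  path from \<open>x\<close> to \<open>y\<close> in \<open>T\<close> that cross \<open>F\<close> are odd in number if and only if \<open>F\<close> separates \<open>x\<close> from \<open>y\<close>.\<close>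

lemma sum_tree_separating_forest:
  assumes "finite E" and "finite U" and "x \<notin> E" and "y \<notin> E"
    and s: "\<And>F. s F = perm2 A (insert x F) U + perm2 A (insert y F) U"
  shows "(\<Sum>(T, F)\<in>disjoint_pairs E. perm2 A T U * s F *
      (s F + (\<Sum>e\<in>E. \<Sum>j\<in>U. A e j * perm2 A F (U - {j})))) = 0"
proof -
  \<comment> \<open>The Pluecker relation for \<open>insert z T\<close> and \<open>F\<close> with
    the term of \<open>z\<close> isolated; the cases \<open>z = x\<close> and \<open>z = y\<close>
    are added.\<close>
  have move: "(\<Sum>t\<in>T. s (T - {t}) * perm2 A (insert t F) U) = perm2 A T U * s F"
    if "(T, F) \<in> disjoint_pairs E" for T F
  proof -
    have TF: "T \<subseteq> E" "F \<subseteq> E" "T \<inter> F = {}" "finite T" "finite F"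
      using assms that by (auto simp: disjoint_pairs_def intro: rev_finite_subset)
    have "(\<Sum>t\<in>T. perm2 A (insert z (T - {t})) U * perm2 A (insert t F) U) =
        perm2 A T U * perm2 A (insert z F) U" if "z \<notin> E" for z
    proof -
      have "insert z T - F = insert z T" "z \<notin> T"
        using that TF by auto
      then have "0 = (\<Sum>e\<in>insert z T. perm2 A (insert z T - {e}) U * perm2 A (insert e F) U)"
        using perm2_plucker_insert[of "insert z T" F U A] TF assms(2) by simp
      also have "\<dots> = perm2 A T U * perm2 A (insert z F) U +
          (\<Sum>t\<in>T. perm2 A (insert z T - {t}) U * perm2 A (insert t F) U)"
        using TF \<open>z \<notin> T\<close> by simp
      also have "(\<Sum>t\<in>T. perm2 A (insert z T - {t}) U * perm2 A (insert t F) U) =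
          (\<Sum>t\<in>T. perm2 A (insert z (T - {t})) U * perm2 A (insert t F) U)"
        using \<open>z \<notin> T\<close> by (intro sum.cong) (auto simp: insert_Diff_if)
      finally show ?thesis
        by (subst bit_eq_iff_add_eq_0) (simp add: add.commute)
    qed
    then show ?thesis
      using assms by (simp add: distrib_left distrib_right sum.distrib)
  qed
  have "(\<Sum>(T, F)\<in>disjoint_pairs E. perm2 A T U * s F *
      (s F + (\<Sum>e\<in>E. \<Sum>j\<in>U. A e j * perm2 A F (U - {j})))) =
      (\<Sum>(T, F)\<in>disjoint_pairs E. perm2 A T U * s F) +
      (\<Sum>(T, F)\<in>disjoint_pairs E. \<Sum>t\<in>T. perm2 A T U * s F * perm2 A (insert t F) U) +
      (\<Sum>(T, F)\<in>disjoint_pairs E. perm2 A T U * s F * (\<Sum>e\<in>E - T - F. perm2 A (insert e F) U))"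
    unfolding sum.distrib[symmetric]
  proof (intro sum.cong refl, clarify)
    fix T F assume "(T, F) \<in> disjoint_pairs E"
    then show "perm2 A T U * s F * (s F + (\<Sum>e\<in>E. \<Sum>j\<in>U. A e j * perm2 A F (U - {j}))) =
        perm2 A T U * s F + (\<Sum>t\<in>T. perm2 A T U * s F * perm2 A (insert t F) U) +
        perm2 A T U * s F * (\<Sum>e\<in>E - T - F. perm2 A (insert e F) U)"
      unfolding sum_columns_split[OF assms(1,2)]
      by (simp add: sum_columns_split[OF assms(1,2)] distrib_left mult.assoc flip: sum_distrib_left)
  qed
  also have "(\<Sum>(T, F)\<in>disjoint_pairs E. perm2 A T U * s F * (\<Sum>e\<in>E - T - F. perm2 A (insert e F) U)) = 0"
    using assms(1,2) by (rule sum_disjoint_pairs_free_edge)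
  \<comment> \<open>After this exchange of roles \<open>move\<close> evaluates the inner sum, and
    the result cancels against the first sum.\<close>
  also have "(\<Sum>(T, F)\<in>disjoint_pairs E. \<Sum>t\<in>T. perm2 A T U * s F * perm2 A (insert t F) U) =
      (\<Sum>(T, F)\<in>disjoint_pairs E. \<Sum>t\<in>T.
        perm2 A (insert t F) U * s (T - {t}) * perm2 A (insert t (T - {t})) U)"
    using assms(1) by (rule sum_disjoint_pairs_move)
  also have "\<dots> = (\<Sum>(T, F)\<in>disjoint_pairs E. perm2 A T U * (\<Sum>t\<in>T. s (T - {t}) * perm2 A (insert t F) U))"
    by (intro sum.cong) (auto simp: sum_distrib_left ac_simps insert_absorb)
  also have "\<dots> = (\<Sum>(T, F)\<in>disjoint_pairs E. perm2 A T U * s F)"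
    by (intro sum.cong) (auto simp: move simp flip: mult.assoc)
  finally show ?thesis
    by simp
qed

section \<open>Trees and separating forests at a vertex\<close>

text \<open>The last factor is a disjunction modulo two. If \<open>R\<close> omits the root of the graph and \<open>a\<close>, \<open>b\<close>
  join a new vertex to the graph, it says that the spanning 2-forest \<open>F\<close> separates the root from
  the end of \<open>a\<close> or from the end of \<open>b\<close>.\<close>

definition crossing :: "('e \<Rightarrow> 'v \<Rightarrow> bit) \<Rightarrow> 'e set \<Rightarrow> 'v set \<Rightarrow> 'e \<Rightarrow> 'e \<Rightarrow> bit" where
  "crossing A E R a b = (\<Sum>(T, F)\<in>disjoint_pairs E. perm2 A T R *
    (perm2 A (insert a F) R + perm2 A (insert b F) R + perm2 A (insert a F) R * perm2 A (insert b F) R))"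

section \<open>Minors of columns with even sum\<close>

context
  fixes A :: "'e \<Rightarrow> 'v \<Rightarrow> bit" and E :: "'e set" and U :: "'v set" and r :: 'v
  assumes fin: "finite E" "finite U" and r: "r \<notin> U"
    and even: "\<And>e. e \<in> E \<Longrightarrow> (\<Sum>j\<in>insert r U. A e j) = 0"
begin

lemma perm2_even:
  assumes "F \<subseteq> E"
  shows "perm2 A F (insert r U) = 0"
proof -
  have "finite F"
    using assms fin(1) finite_subset by blast
  then show ?thesis
    using assms even fin r by (subst perm2_row_sum) (auto intro!: sum.neutral)
qed

text \<open>Once the row \<open>r\<close> is replaced by the sum of all rows, the columns of
  \<open>F\<close> vanish there and only \<open>x\<close> contributes.\<close>

lemma perm2_even_insert:
  assumes "F \<subseteq> E" and "x \<notin> E"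
  shows "perm2 A (insert x F) (insert r U) = (\<Sum>j\<in>insert r U. A x j) * perm2 A F U"
proof -
  have F: "finite F" "x \<notin> F" and z: "\<And>e. e \<in> F \<Longrightarrow> (\<Sum>j\<in>insert r U. A e j) = 0"
    using assms fin(1) even finite_subset by auto
  have "perm2 A (insert x F) (insert r U) =
      (\<Sum>e\<in>insert x F. (\<Sum>j\<in>insert r U. A e j) * perm2 A (insert x F - {e}) U)"
    using F fin r by (intro perm2_row_sum) auto
  also have "\<dots> = (\<Sum>j\<in>insert r U. A x j) * perm2 A (insert x F - {x}) U +
      (\<Sum>e\<in>F. (\<Sum>j\<in>insert r U. A e j) * perm2 A (insert x F - {e}) U)"
    using F by (intro sum.insert) auto
  also have "(\<Sum>e\<in>F. (\<Sum>j\<in>insert r U. A e j) * perm2 A (insert x F - {e}) U) = 0"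
    using z by simp
  finally show ?thesis
    using F by simp
qed

lemma perm2_even_insert2:
  assumes "F \<subseteq> E" and "x \<notin> E" and "y \<notin> E" and "x \<noteq> y"
    and "(\<Sum>j\<in>insert r U. A x j) = 1" and "(\<Sum>j\<in>insert r U. A y j) = 1"
  shows "perm2 A (insert x (insert y F)) (insert r U) = perm2 A (insert x F) U + perm2 A (insert y F) U"
proof -
  have F: "finite F" "x \<notin> F" "y \<notin> F" and z: "\<And>e. e \<in> F \<Longrightarrow> (\<Sum>j\<in>insert r U. A e j) = 0"
    using assms fin(1) even finite_subset by auto
  let ?X = "insert x (insert y F)"
  have "perm2 A ?X (insert r U) = (\<Sum>e\<in>?X. (\<Sum>j\<in>insert r U. A e j) * perm2 A (?X - {e}) U)"
    using F fin r by (intro perm2_row_sum) auto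
  also have "\<dots> = (\<Sum>e\<in>{x, y}. (\<Sum>j\<in>insert r U. A e j) * perm2 A (?X - {e}) U)"
    using F z by (intro sum.mono_neutral_right) auto
  also have "\<dots> = perm2 A (?X - {x}) U + perm2 A (?X - {y}) U"
    using assms(4-6) by simp
  also have "?X - {x} = insert y F"
    using F assms(4) by auto
  also have "?X - {y} = insert x F"
    using F assms(4) by auto
  finally show ?thesis
    by (simp add: add.commute)
qed

lemma crossing_even: "crossing A E (insert r U) a b = 0"
  unfolding crossing_def by (rule sum.neutral) (auto simp: disjoint_pairs_def perm2_even)

text \<open>Only sets \<open>T\<close> containing \<open>x\<close> can have a nonzero minor. After a
  constant is factored out, the remaining sum is symmetric in \<open>T\<close> and
  \<open>F\<close>.\<close>

lemma crossing_even_insert: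
  assumes "x \<notin> E" and "a \<notin> insert x E" and "b \<notin> insert x E" and "U \<noteq> {}"
  shows "crossing A (insert x E) (insert r U) a b = 0"
proof -
  let ?c = "\<lambda>e. \<Sum>j\<in>insert r U. A e j"
  let ?k = "?c x * (?c a + ?c b + ?c a * ?c b)"
  have "crossing A (insert x E) (insert r U) a b =
      (\<Sum>(T, F)\<in>disjoint_pairs E. ?k * perm2 A T U * perm2 A F U)"
    unfolding crossing_def sum_disjoint_pairs_insert[OF fin(1) assms(1)]
  proof (intro sum.cong refl, clarify)
    fix T F assume "(T, F) \<in> disjoint_pairs E"
    then have TF: "T \<subseteq> E" "F \<subseteq> E"
      by (auto simp: disjoint_pairs_def)
    let ?g = "\<lambda>F. perm2 A (insert a F) (insert r U) + perm2 A (insert b F) (insert r U) +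
      perm2 A (insert a F) (insert r U) * perm2 A (insert b F) (insert r U)"
    have "?g F = (?c a + ?c b + ?c a * ?c b) * perm2 A F U"
      using TF assms by (cases "perm2 A F U") (simp_all add: perm2_even_insert)
    moreover have "perm2 A T (insert r U) = 0"
      using TF(1) by (rule perm2_even)
    moreover have "perm2 A (insert x T) (insert r U) = ?c x * perm2 A T U"
      using TF(1) assms(1) by (rule perm2_even_insert)
    ultimately show "perm2 A T (insert r U) * ?g F + perm2 A (insert x T) (insert r U) * ?g F +
        perm2 A T (insert r U) * ?g (insert x F) = ?k * perm2 A T U * perm2 A F U"
      by (simp only: mult_zero_left add_0 add_0_right) (simp only: ac_simps)
  qed
  also have "\<dots> = 0"
    by (rule sum_disjoint_pairs_symmetric) (use fin assms(4) in \<open>auto simp: perm2_empty ac_simps\<close>)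
  finally show ?thesis .
qed

text \<open>The columns \<open>x\<close> and \<open>y\<close> are distributed over \<open>T\<close>,
  \<open>F\<close> and neither, and \<open>T\<close> has to receive at least one. If it receives one
  and \<open>F\<close> none, the two choices cancel; both in \<open>T\<close> gives
  \<open>s T * perm2 A F U\<close>, and one in each gives the other two terms.\<close>

lemma crossing_even_insert2:
  assumes xy: "x \<notin> E" "y \<notin> E" "x \<noteq> y"
    and ab: "a \<notin> insert x (insert y E)" "b \<notin> insert x (insert y E)"
    and odd: "\<And>e. e \<in> {x, y, a, b} \<Longrightarrow> (\<Sum>j\<in>insert r U. A e j) = 1"
  shows "crossing A (insert x (insert y E)) (insert r U) a b =
    (\<Sum>(T, F)\<in>disjoint_pairs E. perm2 A T U * (perm2 A (insert x F) U + perm2 A (insert y F) U) *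
      (perm2 A (insert a F) U + perm2 A (insert b F) U))"
proof -
  let ?R = "insert r U"
  define g where "g F = perm2 A (insert a F) ?R + perm2 A (insert b F) ?R +
    perm2 A (insert a F) ?R * perm2 A (insert b F) ?R" for F
  define s where "s F = perm2 A (insert x F) U + perm2 A (insert y F) U" for F
  define u where "u F = perm2 A (insert a F) U + perm2 A (insert b F) U" for F
  have expand: "p + X + (q + X) + (p + X) * (q + X) + (p + Y + (q + Y) + (p + Y) * (q + Y)) =
      X + Y + (X + Y) * (p + q)" for p q X Y :: bit
    by (cases p; cases q; cases X; cases Y) simp_all
  have "x \<notin> insert y E"
    using xy by simp
  have "crossing A (insert x (insert y E)) ?R a b =
      (\<Sum>(T, F)\<in>disjoint_pairs E. s T * perm2 A F U + (perm2 A T U * s F + perm2 A T U * s F * u F))"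
    unfolding crossing_def g_def[symmetric]
      sum_disjoint_pairs_insert[OF finite.insertI[OF fin(1)] \<open>x \<notin> insert y E\<close>]
      sum_disjoint_pairs_insert[OF fin(1) xy(2)]
  proof (intro sum.cong refl, clarify)
    fix T F assume "(T, F) \<in> disjoint_pairs E"
    then have TF: "T \<subseteq> E" "F \<subseteq> E"
      by (auto simp: disjoint_pairs_def)
    have T: "perm2 A T ?R = 0" "perm2 A (insert x T) ?R = perm2 A T U" "perm2 A (insert y T) ?R = perm2 A T U"
      "perm2 A (insert x (insert y T)) ?R = s T"
      using TF(1) xy odd by (simp_all add: perm2_even perm2_even_insert perm2_even_insert2 s_def del: sum.insert)
    have F1: "perm2 A (insert e F) ?R = perm2 A F U" if "e \<in> {a, b}" for e
      using that TF(2) ab odd by (auto simp: perm2_even_insert simp del: sum.insert)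
    have F2: "perm2 A (insert e (insert z F)) ?R = perm2 A (insert e F) U + perm2 A (insert z F) U"
      if "e \<in> {a, b}" "z \<in> {x, y}" for e z
      using that TF(2) xy ab odd by (auto simp: perm2_even_insert2 simp del: sum.insert)
    have g1: "g F = perm2 A F U"
      by (simp add: g_def F1)
    have g2: "g (insert x F) + g (insert y F) = s F + s F * u F"
      unfolding g_def s_def u_def F2[of a x, simplified] F2[of b x, simplified]
        F2[of a y, simplified] F2[of b y, simplified] by (rule expand)
    show "perm2 A T ?R * g F + perm2 A (insert x T) ?R * g F + perm2 A T ?R * g (insert x F) +
        (perm2 A (insert y T) ?R * g F + perm2 A (insert x (insert y T)) ?R * g F +
          perm2 A (insert y T) ?R * g (insert x F)) +
        (perm2 A T ?R * g (insert y F) + perm2 A (insert x T) ?R * g (insert y F) +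
          perm2 A T ?R * g (insert x (insert y F))) =
        s T * perm2 A F U + (perm2 A T U * s F + perm2 A T U * s F * u F)"
      unfolding T g1 by (simp add: ac_simps flip: distrib_left)
        (simp only: g2, simp add: distrib_left ac_simps)
  qed
  also have "\<dots> = (\<Sum>(T, F)\<in>disjoint_pairs E. s T * perm2 A F U) +
      ((\<Sum>(T, F)\<in>disjoint_pairs E. perm2 A T U * s F) + (\<Sum>(T, F)\<in>disjoint_pairs E. perm2 A T U * s F * u F))"
    by (simp add: sum.distrib case_prod_unfold)
  \<comment> \<open>Exchanging \<open>T\<close> and \<open>F\<close> makes the first sum cancel
    against the second.\<close>
  also have "(\<Sum>(T, F)\<in>disjoint_pairs E. s T * perm2 A F U) = (\<Sum>(T, F)\<in>disjoint_pairs E. perm2 A T U * s F)"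
    by (subst sum_disjoint_pairs_swap) (simp add: mult.commute)
  finally show ?thesis
    by (simp add: s_def u_def)
qed

end


text \<open>On the rows \<open>U\<close> the column \<open>z\<close> is the sum of \<open>x\<close>,
  \<open>y\<close> and all columns of \<open>E\<close>, so adjoining it to \<open>F\<close> gives
  the weight of \<open>sum_tree_separating_forest\<close>.\<close>

lemma sum_tree_separating_forest_rows:
  assumes "finite E" and "finite U" and "x \<notin> E" and "y \<notin> E"
    and rows: "\<And>j. j \<in> U \<Longrightarrow> z j = A x j + A y j + (\<Sum>e\<in>E. A e j)"
  shows "(\<Sum>(T, F)\<in>disjoint_pairs E. perm2 A T U * (perm2 A (insert x F) U + perm2 A (insert y F) U) *
    (\<Sum>j\<in>U. z j * perm2 A F (U - {j}))) = 0"
proof -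
  define s where "s F = perm2 A (insert x F) U + perm2 A (insert y F) U" for F
  have "(\<Sum>j\<in>U. z j * perm2 A F (U - {j})) = s F + (\<Sum>e\<in>E. \<Sum>j\<in>U. A e j * perm2 A F (U - {j}))"
    if "(T, F) \<in> disjoint_pairs E" for T F
  proof -
    have F: "finite F" "x \<notin> F" "y \<notin> F"
      using that assms by (auto simp: disjoint_pairs_def intro: rev_finite_subset)
    have "(\<Sum>j\<in>U. z j * perm2 A F (U - {j})) =
        (\<Sum>j\<in>U. A x j * perm2 A F (U - {j})) + (\<Sum>j\<in>U. A y j * perm2 A F (U - {j})) +
        (\<Sum>j\<in>U. \<Sum>e\<in>E. A e j * perm2 A F (U - {j}))"
      by (simp add: rows distrib_right sum_distrib_right sum.distrib)
    also have "(\<Sum>j\<in>U. \<Sum>e\<in>E. A e j * perm2 A F (U - {j})) =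
        (\<Sum>e\<in>E. \<Sum>j\<in>U. A e j * perm2 A F (U - {j}))"
      by (rule sum.swap)
    finally show ?thesis
      using F assms(2) by (simp add: s_def perm2_column)
  qed
  then have "(\<Sum>(T, F)\<in>disjoint_pairs E. perm2 A T U * s F * (\<Sum>j\<in>U. z j * perm2 A F (U - {j}))) =
      (\<Sum>(T, F)\<in>disjoint_pairs E. perm2 A T U * s F *
        (s F + (\<Sum>e\<in>E. \<Sum>j\<in>U. A e j * perm2 A F (U - {j}))))"
    by (intro sum.cong) auto
  also have "\<dots> = 0"
    using assms(1-4) by (rule sum_tree_separating_forest) (rule s_def)
  finally show ?thesis
    by (simp only: s_def)
qed

section \<open>Matrices with at most two columns of odd sum\<close>

text \<open>For an incidence matrix with a root left out of \<open>R\<close>, the odd columns are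
  the edges joining the root to \<open>R\<close>.\<close>

locale few_odd_columns =
  fixes A :: "'e \<Rightarrow> 'v \<Rightarrow> bit" and E :: "'e set" and R :: "'v set"
  assumes fin: "finite E" "finite R"
    and card_R: "card R \<ge> 2"
    and card_odd: "card {e \<in> E. (\<Sum>j\<in>R. A e j) = 1} \<le> 2"
begin

abbreviation odd_col :: "'e \<Rightarrow> bool" where
  "odd_col e \<equiv> (\<Sum>j\<in>R. A e j) = 1"

lemma odd_columns_cases:
  obtains (none) r U where "R = insert r U" "r \<notin> U" "finite U" "U \<noteq> {}"
      "\<And>e. e \<in> E \<Longrightarrow> (\<Sum>j\<in>insert r U. A e j) = 0"
  | (one) r U x D where "R = insert r U" "r \<notin> U" "finite U" "U \<noteq> {}" "E = insert x D" "x \<notin> D" "finite D"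
      "\<And>e. e \<in> D \<Longrightarrow> (\<Sum>j\<in>insert r U. A e j) = 0" "odd_col x"
  | (two) r U x y D where "R = insert r U" "r \<notin> U" "finite U" "U \<noteq> {}"
      "E = insert x (insert y D)" "x \<notin> D" "y \<notin> D" "x \<noteq> y" "finite D"
      "\<And>e. e \<in> D \<Longrightarrow> (\<Sum>j\<in>insert r U. A e j) = 0" "odd_col x" "odd_col y"
      "card {e \<in> E. odd_col e} = 2"
proof -
  have "R \<noteq> {}"
    using card_R by auto
  then obtain r where r: "r \<in> R"
    by blast
  define U where "U = R - {r}"
  have U: "R = insert r U" "r \<notin> U" "finite U"
    using r fin by (auto simp: U_def)
  moreover have "U \<noteq> {}"
    using U card_R by auto
  moreover define C where "C = {e \<in> E. odd_col e}"
  moreover define D where "D = E - C"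
  moreover have D: "(\<Sum>j\<in>insert r U. A e j) = 0" if "e \<in> D" for e
    using that U by (auto simp: D_def C_def)
  moreover have "E = C \<union> D" "C \<inter> D = {}" "finite D"
    using fin by (auto simp: C_def D_def)
  moreover consider "card C = 0" | "card C = 1" | "card C = 2"
    using card_odd unfolding C_def by linarith
  then show ?thesis
  proof cases
    case 1
    then have "C = {}"
      using fin by (simp add: C_def)
    then show ?thesis
      using none[of r U] U \<open>U \<noteq> {}\<close> D \<open>E = C \<union> D\<close> by blast
  next
    case 2
    then obtain x where x: "C = {x}"
      by (auto simp: card_1_singleton_iff)
    then have "odd_col x"
      unfolding C_def by blast
    then show ?thesis
      using one[of r U x D] U \<open>U \<noteq> {}\<close> D \<open>E = C \<union> D\<close> \<open>C \<inter> D = {}\<close> \<open>finite D\<close> x by auto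
  next
    case 3
    then obtain x y where xy: "C = {x, y}" "x \<noteq> y"
      by (auto simp: card_2_iff)
    then have "odd_col x" "odd_col y"
      unfolding C_def by blast+
    then show ?thesis
      using two[of r U x y D] U \<open>U \<noteq> {}\<close> D \<open>E = C \<union> D\<close> \<open>C \<inter> D = {}\<close> \<open>finite D\<close> xy 3
      unfolding C_def[symmetric] by auto
  qed
qed

text \<open>With fewer than two odd columns both sides vanish. With two, both sides are linear in
  the sum of the attached columns, so their sum involves \<open>a\<close>, \<open>b\<close>,
  \<open>c\<close>, \<open>d\<close> only through the total, which by \<open>rows\<close> is the sum
  of all columns of \<open>E\<close>; the exchange argument makes it zero.\<close>

lemma crossing_eq:
  assumes "a \<notin> E" "b \<notin> E" "c \<notin> E" "d \<notin> E"
    and odd: "\<And>e. card {e \<in> E. odd_col e} = 2 \<Longrightarrow> e \<in> {a, b, c, d} \<Longrightarrow> odd_col e"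
    and rows: "\<And>j. j \<in> R \<Longrightarrow> (\<Sum>e\<in>E. A e j) = A a j + A b j + A c j + A d j"
  shows "crossing A E R a b = crossing A E R c d"
proof (cases rule: odd_columns_cases)
  case (none r U)
  have "crossing A E R p q = 0" for p q
    unfolding none(1) by (rule crossing_even[OF fin(1) none(3,2)]) (rule none(5))
  then show ?thesis
    by simp
next
  case (one r U x D)
  have "crossing A E R p q = 0" if "p \<notin> E" "q \<notin> E" for p q
    using that unfolding one(1,5) by (intro crossing_even_insert one(7,3,2,8,6,4))
  then show ?thesis
    using assms(1-4) by simp
next
  case (two r U x y D)
  let ?s = "\<lambda>F. perm2 A (insert x F) U + perm2 A (insert y F) U"
  let ?z = "\<lambda>j. A a j + A b j + A c j + A d j"
  have eq: "crossing A E R p q = (\<Sum>(T, F)\<in>disjoint_pairs D. perm2 A T U * ?s F *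
      (perm2 A (insert p F) U + perm2 A (insert q F) U))" if "{p, q} \<subseteq> {a, b, c, d}" for p q
  proof -
    have "odd_col e" if "e \<in> {x, y, p, q}" for e
      using that \<open>{p, q} \<subseteq> _\<close> odd[OF two(13)] two(11,12) by blast
    then have odd': "(\<Sum>j\<in>insert r U. A e j) = 1" if "e \<in> {x, y, p, q}" for e
      using that unfolding two(1) by blast
    have "p \<notin> E" "q \<notin> E"
      using that assms(1-4) by blast+
    then show ?thesis
      unfolding two(1,5) by (intro crossing_even_insert2 two(9,3,2,10,6,7,8) odd')
  qed
  have "crossing A E R a b + crossing A E R c d =
      (\<Sum>(T, F)\<in>disjoint_pairs D. perm2 A T U * ?s F * (\<Sum>j\<in>U. ?z j * perm2 A F (U - {j})))"
    unfolding eq[of a b, simplified] eq[of c d, simplified] sum.distrib[symmetric]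
  proof (intro sum.cong refl, clarify)
    fix T F assume "(T, F) \<in> disjoint_pairs D"
    then have F: "finite F" "F \<subseteq> D"
      using two(9) by (auto simp: disjoint_pairs_def intro: rev_finite_subset)
    then have "perm2 A (insert e F) U = (\<Sum>j\<in>U. A e j * perm2 A F (U - {j}))" if "e \<in> {a, b, c, d}" for e
      using that two(3,5) assms(1-4) by (intro perm2_column) auto
    then have "(\<Sum>j\<in>U. ?z j * perm2 A F (U - {j})) =
        perm2 A (insert a F) U + perm2 A (insert b F) U + (perm2 A (insert c F) U + perm2 A (insert d F) U)"
      by (simp add: distrib_right sum.distrib)
    then show "perm2 A T U * ?s F * (perm2 A (insert a F) U + perm2 A (insert b F) U) +
        perm2 A T U * ?s F * (perm2 A (insert c F) U + perm2 A (insert d F) U) =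
        perm2 A T U * ?s F * (\<Sum>j\<in>U. ?z j * perm2 A F (U - {j}))"
      by (simp only: distrib_left)
  qed
  also have "\<dots> = 0"
  proof (rule sum_tree_separating_forest_rows)
    show "?z j = A x j + A y j + (\<Sum>e\<in>D. A e j)" if "j \<in> U" for j
      using rows[of j] that two(5-9) unfolding two(1) by (simp add: add.assoc)
  qed (use two(3,6,7,9) in auto)
  finally show ?thesis
    by (simp flip: bit_eq_iff_add_eq_0)
qed

text \<open>The argument of \<open>crossing_eq\<close> with a single attached pair, whose sum is
  already that of all columns of \<open>E\<close>. It serves the case in which the opposite vertex
  carries a self-loop.\<close>

lemma crossing_eq_0:
  assumes "a \<notin> E" "b \<notin> E"
    and odd: "\<And>e. card {e \<in> E. odd_col e} = 2 \<Longrightarrow> e \<in> {a, b} \<Longrightarrow> odd_col e"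
    and rows: "\<And>j. j \<in> R \<Longrightarrow> (\<Sum>e\<in>E. A e j) = A a j + A b j"
  shows "crossing A E R a b = 0"
proof (cases rule: odd_columns_cases)
  case (none r U)
  have "crossing A E R p q = 0" for p q
    unfolding none(1) by (rule crossing_even[OF fin(1) none(3,2)]) (rule none(5))
  then show ?thesis
    by simp
next
  case (one r U x D)
  have "crossing A E R p q = 0" if "p \<notin> E" "q \<notin> E" for p q
    using that unfolding one(1,5) by (intro crossing_even_insert one(7,3,2,8,6,4))
  then show ?thesis
    using assms(1,2) by simp
next
  case (two r U x y D)
  let ?s = "\<lambda>F. perm2 A (insert x F) U + perm2 A (insert y F) U"
  let ?z = "\<lambda>j. A a j + A b j"
  have "crossing A E R a b = (\<Sum>(T, F)\<in>disjoint_pairs D. perm2 A T U * ?s F *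
      (perm2 A (insert a F) U + perm2 A (insert b F) U))"
  proof -
    have "odd_col e" if "e \<in> {x, y, a, b}" for e
      using that odd[OF two(13)] two(11,12) by blast
    then have odd': "(\<Sum>j\<in>insert r U. A e j) = 1" if "e \<in> {x, y, a, b}" for e
      using that unfolding two(1) by blast
    show ?thesis
      using assms(1,2) unfolding two(1,5) by (intro crossing_even_insert2 two(9,3,2,10,6,7,8) odd')
  qed
  also have "\<dots> = (\<Sum>(T, F)\<in>disjoint_pairs D. perm2 A T U * ?s F * (\<Sum>j\<in>U. ?z j * perm2 A F (U - {j})))"
  proof (intro sum.cong refl, clarify)
    fix T F assume "(T, F) \<in> disjoint_pairs D"
    then have F: "finite F" "F \<subseteq> D"
      using two(9) by (auto simp: disjoint_pairs_def intro: rev_finite_subset)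
    then have "perm2 A (insert e F) U = (\<Sum>j\<in>U. A e j * perm2 A F (U - {j}))" if "e \<in> {a, b}" for e
      using that two(3,5) assms(1,2) by (intro perm2_column) auto
    then show "perm2 A T U * ?s F * (perm2 A (insert a F) U + perm2 A (insert b F) U) =
        perm2 A T U * ?s F * (\<Sum>j\<in>U. ?z j * perm2 A F (U - {j}))"
      by (simp add: distrib_right sum.distrib)
  qed
  also have "\<dots> = 0"
  proof (rule sum_tree_separating_forest_rows)
    show "?z j = A x j + A y j + (\<Sum>e\<in>D. A e j)" if "j \<in> U" for j
      using rows[of j] that two(5-9) unfolding two(1) by (simp add: add.assoc)
  qed (use two(3,6,7,9) in auto)
  finally show ?thesis .
qed

end

section \<open>Counting points\<close>

lemma card_PiE_eq_sum:
  "finite E \<Longrightarrow> card {x \<in> E \<rightarrow>\<^sub>E (UNIV :: bit set). P x} = (\<Sum>x\<in>E \<rightarrow>\<^sub>E UNIV. of_bool (P x))"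
  by (simp add: sum_of_bool_eq finite_PiE Int_def)

lemma card_PiE_insert:
  assumes "finite E" and "e \<notin> E"
  shows "card {x \<in> insert e E \<rightarrow>\<^sub>E (UNIV :: bit set). P x} =
    card {x \<in> E \<rightarrow>\<^sub>E UNIV. P (x(e := 0))} + card {x \<in> E \<rightarrow>\<^sub>E UNIV. P (x(e := 1))}"
  using assms by (simp add: card_PiE_eq_sum sum_PiE_insert sum.distrib)

lemma of_nat_card_PiE:
  "finite E \<Longrightarrow> (of_nat (card {x \<in> E \<rightarrow>\<^sub>E (UNIV :: bit set). P x}) :: bit) = (\<Sum>x\<in>E \<rightarrow>\<^sub>E UNIV. of_bool (P x))"
  by (simp add: card_PiE_eq_sum)

lemma sum_PiE_one: "finite E \<Longrightarrow> (\<Sum>x\<in>E \<rightarrow>\<^sub>E (UNIV :: bit set). 1) = (of_nat (2 ^ card E) :: bit)"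
  by (simp add: card_PiE card_bit)

lemma parity_zeros:
  assumes "finite E"
  shows "(of_nat (card {x \<in> E \<rightarrow>\<^sub>E UNIV. cpoly E h x = 0}) :: bit) = of_nat (2 ^ card E) + h {}"
proof -
  have "of_bool (cpoly E h x = 0) = 1 + cpoly E h x" for x
    by (cases "cpoly E h x") simp_all
  then show ?thesis
    using assms by (simp only: of_nat_card_PiE sum.distrib sum_cpoly sum_PiE_one)
qed

text \<open>The indicator of a common zero is the product of one plus each value, and its four terms
  are summed separately.\<close>

lemma parity_common_zeros2:
  assumes "finite E"
  shows "(of_nat (card {x \<in> E \<rightarrow>\<^sub>E UNIV. cpoly E h x = 0 \<and> cpoly E k x = 0}) :: bit) =
    of_nat (2 ^ card E) + h {} + k {} + (\<Sum>(T, F)\<in>disjoint_pairs E. h T * k F)"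
proof -
  have "of_bool (cpoly E h x = 0 \<and> cpoly E k x = 0) =
      1 + cpoly E h x + cpoly E k x + cpoly E h x * cpoly E k x" for x
    by (cases "cpoly E h x"; cases "cpoly E k x") simp_all
  then show ?thesis
    using assms by (simp only: of_nat_card_PiE sum.distrib sum_cpoly sum_PiE_one sum_cpoly_mult)
qed

text \<open>On the zeros of the first polynomial, condensation turns the product of the other two
  into a polynomial of the same form, so their simultaneous vanishing becomes the single equation
  \<open>cpoly E k x = 0\<close>.\<close>

lemma parity_common_zeros:
  assumes "finite E" and "finite R" and "card R \<ge> 2" and "a \<notin> E" and "b \<notin> E" and "a \<noteq> b"
  shows "(of_nat (card {x \<in> E \<rightarrow>\<^sub>E UNIV. cpoly E (\<lambda>T. perm2 A T R) x = 0 \<and>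
      cpoly E (\<lambda>T. perm2 A (insert a T) R) x = 0 \<and> cpoly E (\<lambda>T. perm2 A (insert b T) R) x = 0}) :: bit) =
    of_nat (2 ^ card E) + crossing A E R a b"
proof -
  define h where "h = (\<lambda>T. perm2 A T R)"
  define k where "k = (\<lambda>T. perm2 A (insert a T) R + perm2 A (insert b T) R +
    perm2 A (insert a T) R * perm2 A (insert b T) R)"
  let ?a = "\<lambda>T. perm2 A (insert a T) R" and ?b = "\<lambda>T. perm2 A (insert b T) R"
  have "cpoly E h x = 0 \<and> cpoly E ?a x = 0 \<and> cpoly E ?b x = 0 \<longleftrightarrow> cpoly E h x = 0 \<and> cpoly E k x = 0" for x
  proof (cases "cpoly E h x = 0")
    case True
    then have "cpoly E k x = cpoly E ?a x + cpoly E ?b x + cpoly E ?a x * cpoly E ?b x"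
      using cpoly_perm2_dodgson[of E R a b A x] assms by (simp add: k_def h_def cpoly_add)
    then show ?thesis
      using True by (cases "cpoly E ?a x"; cases "cpoly E ?b x") simp_all
  qed simp
  \<comment> \<open>Since \<open>R\<close> has at least two rows, the coefficients at the empty set
    vanish.\<close>
  moreover have "perm2 A S R = 0" if "finite S" "card S \<le> 1" for S
    using that assms(3) by (intro perm2_card_neq) auto
  then have "h {} = 0" "k {} = 0"
    by (simp_all add: h_def k_def)
  ultimately show ?thesis
    using parity_common_zeros2[OF assms(1), of h k] by (simp add: crossing_def h_def k_def)
qed


lemma sum_UNIV_bit: "(\<Sum>b\<in>(UNIV :: bit set). f b) = f 0 + f 1"
  by (simp add: UNIV_bit)

lemma sum_PiE_const_of_bool:
  fixes c d :: nat
  assumes "finite E"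
  shows "(\<Sum>z\<in>E \<rightarrow>\<^sub>E (UNIV :: bit set). c + d * of_bool (P z)) =
    c * 2 ^ card E + d * card {z \<in> E \<rightarrow>\<^sub>E UNIV. P z}"
proof -
  have "(\<Sum>z\<in>E \<rightarrow>\<^sub>E (UNIV :: bit set). c) = c * 2 ^ card E"
    using assms by (simp add: card_PiE card_bit)
  then show ?thesis
    by (simp only: sum.distrib sum_distrib_left card_PiE_eq_sum[OF assms])
qed

lemma bit_of_nat_eq_0_iff: "(of_nat n :: bit) = 0 \<longleftrightarrow> even n"
  by (induction n) auto

lemma cpoly_even:
  assumes "finite E" and "finite U" and "r \<notin> U" and "\<And>e. e \<in> E \<Longrightarrow> (\<Sum>j\<in>insert r U. A e j) = 0"
  shows "cpoly E (\<lambda>T. perm2 A T (insert r U)) z = 0"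
proof -
  have "perm2 A T (insert r U) = 0" if "T \<subseteq> E" for T
    by (rule perm2_even[OF assms(1-3) _ that]) (rule assms(4))
  then have "cpoly E (\<lambda>T. perm2 A T (insert r U)) z = cpoly E (\<lambda>T. 0) z"
    by (intro cpoly_cong refl)
  then show ?thesis
    by simp
qed

lemma cpoly_even_insert:
  assumes "finite E" and "finite U" and "r \<notin> U" and "\<And>e. e \<in> E \<Longrightarrow> (\<Sum>j\<in>insert r U. A e j) = 0"
    and "x \<notin> E" and "(\<Sum>j\<in>insert r U. A x j) = 1"
  shows "cpoly E (\<lambda>T. perm2 A (insert x T) (insert r U)) z = cpoly E (\<lambda>T. perm2 A T U) z"
proof (rule cpoly_cong)
  fix T assume "T \<subseteq> E"
  then have "perm2 A (insert x T) (insert r U) = (\<Sum>j\<in>insert r U. A x j) * perm2 A T U"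
    using assms(4) by (intro perm2_even_insert[OF assms(1-3) _ _ assms(5)])
  then show "perm2 A (insert x T) (insert r U) = perm2 A T U"
    unfolding assms(6) by simp
qed simp

text \<open>The zeros are counted along fibres over the variables of the even columns. A fibre
  equation reads \<open>0 = 0\<close>, \<open>p = 0\<close> or \<open>b * p + c * p + q = 0\<close>
  for zero, one or two odd columns, where \<open>p\<close> is the polynomial of the even columns
  with the row \<open>r\<close> removed.\<close>

lemma parity_zeros_even_columns:
  fixes A :: "'e \<Rightarrow> 'v \<Rightarrow> bit"
  assumes "few_odd_columns A E R" and "card E \<ge> 2"
  shows "4 dvd card {x \<in> E \<rightarrow>\<^sub>E UNIV. cpoly E (\<lambda>T. perm2 A T R) x = 0}" (is "4 dvd ?n")
proof -
  interpret few_odd_columns A E R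
    by fact
  let ?f = "\<lambda>T. perm2 A T R"
  have four: "4 dvd (2 :: nat) ^ card E"
    using le_imp_power_dvd[OF assms(2), of "2 :: nat"] by simp
  \<comment> \<open>The coefficient at the empty set vanishes for nonempty \<open>U\<close>, so the
    number of zeros has the parity of \<open>2 ^ card D\<close>.\<close>
  have even_zeros: "even (2 ^ card D + card {x \<in> D \<rightarrow>\<^sub>E UNIV. cpoly D (\<lambda>T. perm2 A T U) x = 0})"
    if "finite D" "U \<noteq> {}" for D :: "'e set" and U :: "'v set"
  proof -
    let ?z = "card {x \<in> D \<rightarrow>\<^sub>E UNIV. cpoly D (\<lambda>T. perm2 A T U) x = 0}"
    have "(of_nat (2 ^ card D + ?z) :: bit) = 0"
      unfolding of_nat_add parity_zeros[OF that(1)] using that(2) by (simp add: perm2_empty)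
    then show ?thesis
      by (metis bit_of_nat_eq_0_iff)
  qed
  show ?thesis
  proof (cases rule: odd_columns_cases)
    case (none r U)
    have "cpoly E ?f x = 0" for x
      unfolding none(1) by (intro cpoly_even fin(1) none(2,3,5))
    then have "?n = 2 ^ card E"
      using fin(1) by (simp add: card_PiE card_bit)
    then show ?thesis
      using four by simp
  next
    case (one r U x D)
    have f: "cpoly D (\<lambda>T. perm2 A T R) z = 0" for z
      unfolding one(1) by (intro cpoly_even one(7,3,2,8))
    have fx: "cpoly D (\<lambda>T. perm2 A (insert x T) R) z = cpoly D (\<lambda>T. perm2 A T U) z" for z
      unfolding one(1) by (intro cpoly_even_insert one(7,3,2,8,6) one(9)[unfolded one(1)])
    have "?n = 2 * card {z \<in> D \<rightarrow>\<^sub>E UNIV. cpoly D (\<lambda>T. perm2 A T U) z = 0}"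
      unfolding one(5) card_PiE_insert[OF one(7,6)] cpoly_insert_upd[OF one(7,6)] f fx by simp
    moreover have "card D > 0"
      using assms(2) one(5-7) by simp
    ultimately show ?thesis
      using even_zeros[OF one(7,4)] by auto
  next
    case (two r U x y D)
    define p where "p = cpoly D (\<lambda>T. perm2 A T U)"
    define q where "q = cpoly D (\<lambda>T. perm2 A (insert x (insert y T)) R)"
    have f: "cpoly D (\<lambda>T. perm2 A T R) z = 0" for z
      unfolding two(1) by (intro cpoly_even two(9,3,2,10))
    have fx: "cpoly D (\<lambda>T. perm2 A (insert x T) R) z = p z" for z
      unfolding two(1) p_def by (intro cpoly_even_insert two(9,3,2,10,6) two(11)[unfolded two(1)])
    have fy: "cpoly D (\<lambda>T. perm2 A (insert y T) R) z = p z" for z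
      unfolding two(1) p_def by (intro cpoly_even_insert two(9,3,2,10,7) two(12)[unfolded two(1)])
    have yD: "finite (insert y D)" "x \<notin> insert y D"
      using two(6,8,9) by auto
    have "?n = (\<Sum>z\<in>D \<rightarrow>\<^sub>E UNIV. \<Sum>b\<in>UNIV. \<Sum>c\<in>UNIV. of_bool (b * p z + (c * p z + q z) = 0))"
      unfolding two(5) card_PiE_insert[OF yD] card_PiE_insert[OF two(9,7)]
        cpoly_insert_upd[OF yD] cpoly_insert_upd[OF two(9,7)] f fx fy q_def[symmetric]
      by (simp del: sum_of_bool_eq add: card_PiE_eq_sum[OF two(9)] sum_UNIV_bit sum.distrib)
    \<comment> \<open>A fibre has two zeros if \<open>p z = 1\<close>; otherwise it has four or
      none, according to \<open>q z\<close>. The added term avoids subtraction of natural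
      numbers.\<close>
    also have "\<dots> + 2 * (\<Sum>z\<in>D \<rightarrow>\<^sub>E UNIV. of_bool (p z = 0)) =
        (\<Sum>z\<in>D \<rightarrow>\<^sub>E UNIV. 2 + 4 * of_bool (p z = 0 \<and> q z = 0))"
      unfolding sum_distrib_left sum.distrib[symmetric]
    proof (rule sum.cong)
      fix z
      show "(\<Sum>b\<in>UNIV. \<Sum>c\<in>UNIV. of_bool (b * p z + (c * p z + q z) = 0)) + 2 * of_bool (p z = 0) =
          2 + (4 * of_bool (p z = 0 \<and> q z = 0) :: nat)"
        by (cases "p z"; cases "q z") (simp_all add: sum_UNIV_bit card_bit)
    qed simp
    also have "\<dots> = 2 * 2 ^ card D + 4 * card {z \<in> D \<rightarrow>\<^sub>E UNIV. p z = 0 \<and> q z = 0}"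
      by (rule sum_PiE_const_of_bool[OF two(9)])
    finally have "?n + 2 * card {z \<in> D \<rightarrow>\<^sub>E UNIV. p z = 0} =
        2 * 2 ^ card D + 4 * card {z \<in> D \<rightarrow>\<^sub>E UNIV. p z = 0 \<and> q z = 0}"
      by (simp del: sum_of_bool_eq add: card_PiE_eq_sum[OF two(9)])
    moreover have "4 dvd n" if "n + 2 * z = 2 * m + 4 * k" "even (m + z)" for n z m k :: nat
      using that by presburger
    ultimately show ?thesis
      using even_zeros[OF two(9,4)] unfolding p_def[symmetric] by blast
  qed
qed

section \<open>Attaching a vertex of low degree\<close>

text \<open>In the application \<open>w\<close> is the attached vertex, \<open>E\<close> the edges
  avoiding it, and \<open>i\<close> an edge from \<open>w\<close> to the root omitted from
  \<open>R\<close>, so that its only nonzero entry is at \<open>w\<close>.\<close>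

context
  fixes A :: "'e \<Rightarrow> 'v \<Rightarrow> bit" and E :: "'e set" and R :: "'v set" and w :: 'v and i :: 'e
  assumes fin: "finite E" "finite R" and w: "w \<notin> R" "\<And>e. e \<in> E \<Longrightarrow> A e w = 0"
    and i: "i \<notin> E" "A i w = 1" "\<And>j. j \<in> R \<Longrightarrow> A i j = 0"
begin

lemma perm2_zero_column: "e \<notin> T \<Longrightarrow> finite T \<Longrightarrow> (\<And>j. j \<in> R \<Longrightarrow> A e j = 0) \<Longrightarrow> perm2 A (insert e T) R = 0"
  using fin(2) by (simp add: perm2_column)

lemma perm2_attach_none: "T \<subseteq> E \<Longrightarrow> perm2 A T (insert w R) = 0"
  using fin w by (subst perm2_row) (auto intro: rev_finite_subset intro!: sum.neutral)

text \<open>Expansion along the row \<open>w\<close>, to which only the columns of \<open>X\<close>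
  contribute.\<close>

lemma perm2_attach:
  assumes "T \<subseteq> E" and "finite X" and "X \<inter> E = {}"
  shows "perm2 A (X \<union> T) (insert w R) = (\<Sum>e\<in>X. A e w * perm2 A ((X - {e}) \<union> T) R)"
proof -
  have T: "finite T"
    using assms(1) fin(1) finite_subset by blast
  have "perm2 A (X \<union> T) (insert w R) = (\<Sum>e\<in>X \<union> T. A e w * perm2 A ((X \<union> T) - {e}) R)"
    using T assms(2) fin w by (intro perm2_row) auto
  also have "\<dots> = (\<Sum>e\<in>X. A e w * perm2 A ((X \<union> T) - {e}) R)"
    using T assms w by (intro sum.mono_neutral_right) auto
  also have "\<dots> = (\<Sum>e\<in>X. A e w * perm2 A ((X - {e}) \<union> T) R)"
  proof (rule sum.cong)
    fix e assume "e \<in> X"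
    then have "X \<union> T - {e} = (X - {e}) \<union> T"
      using assms by auto
    then show "A e w * perm2 A (X \<union> T - {e}) R = A e w * perm2 A ((X - {e}) \<union> T) R"
      by simp
  qed simp
  finally show ?thesis .
qed

lemma cpoly_attach_none: "cpoly E (\<lambda>T. perm2 A T (insert w R)) x = 0"
  using cpoly_cong[of E "\<lambda>T. perm2 A T (insert w R)" "\<lambda>T. 0" x x] by (simp add: perm2_attach_none)

lemma cpoly_attach1:
  assumes "a \<notin> E"
  shows "cpoly E (\<lambda>T. perm2 A (insert a T) (insert w R)) x = A a w * cpoly E (\<lambda>T. perm2 A T R) x"
  unfolding cpoly_scale[symmetric] using assms perm2_attach[of _ "{a}"] by (intro cpoly_cong) auto

lemma cpoly_attach2:
  assumes "a \<notin> E" and "b \<notin> E" and "a \<noteq> b"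
  shows "cpoly E (\<lambda>T. perm2 A (insert a (insert b T)) (insert w R)) x =
    A a w * cpoly E (\<lambda>T. perm2 A (insert b T) R) x + A b w * cpoly E (\<lambda>T. perm2 A (insert a T) R) x"
  unfolding cpoly_scale[symmetric] cpoly_add[symmetric]
proof (rule cpoly_cong)
  fix T assume "T \<subseteq> E"
  moreover have "{a, b} - {a} = {b}" "{a, b} - {b} = {a}"
    using assms(3) by auto
  ultimately show "perm2 A (insert a (insert b T)) (insert w R) =
      A a w * perm2 A (insert b T) R + A b w * perm2 A (insert a T) R"
    using perm2_attach[of T "{a, b}"] assms by simp
qed simp

lemma cpoly_attach_root: "cpoly E (\<lambda>T. perm2 A (insert i T) R) x = 0"
proof -
  have "perm2 A (insert i T) R = 0" if "T \<subseteq> E" for T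
    using that fin(1) i by (intro perm2_zero_column) (auto intro: rev_finite_subset)
  then show ?thesis
    using cpoly_cong[of E "\<lambda>T. perm2 A (insert i T) R" "\<lambda>T. 0" x x] by simp
qed

text \<open>If \<open>w\<close> hangs on \<open>i\<close> alone, \<open>i\<close> lies in every
  spanning tree and its variable is absent from the polynomial.\<close>

lemma card_zeros_attach1:
  "card {x \<in> insert i E \<rightarrow>\<^sub>E UNIV. cpoly (insert i E) (\<lambda>T. perm2 A T (insert w R)) x = 0} =
    2 * card {x \<in> E \<rightarrow>\<^sub>E UNIV. cpoly E (\<lambda>T. perm2 A T R) x = 0}"
  using fin(1) i by (simp add: card_PiE_insert cpoly_insert_upd cpoly_attach1 cpoly_attach_none)

text \<open>The loop contributes the factor \<open>x l\<close>, and the variable of \<open>i\<close>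
  is absent.\<close>

lemma card_zeros_attach_loop:
  assumes "l \<notin> E" and "l \<noteq> i" and "A l w = 0" and "\<And>j. j \<in> R \<Longrightarrow> A l j = 0"
  shows "card {x \<in> insert i (insert l E) \<rightarrow>\<^sub>E UNIV.
      cpoly (insert i (insert l E)) (\<lambda>T. perm2 A T (insert w R)) x = 0} =
    2 * (2 ^ card E + card {x \<in> E \<rightarrow>\<^sub>E UNIV. cpoly E (\<lambda>T. perm2 A T R) x = 0})"
proof -
  have "perm2 A (insert l T) R = 0" if "T \<subseteq> E" for T
    using that fin(1) assms by (intro perm2_zero_column) (auto intro: rev_finite_subset)
  then have "cpoly E (\<lambda>T. perm2 A (insert l T) R) x = 0" for x
    using cpoly_cong[of E "\<lambda>T. perm2 A (insert l T) R" "\<lambda>T. 0" x x] by simp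
  moreover have "finite (insert l E)" "i \<notin> insert l E"
    using fin(1) i(1) assms(2) by auto
  ultimately show ?thesis
    using fin(1) i assms by (simp add: card_PiE_insert cpoly_insert_upd cpoly_attach1 cpoly_attach2
        cpoly_attach_none cpoly_attach_root card_PiE card_bit insert_commute)
qed

text \<open>The polynomial is \<open>x i * p + (x a * p + q)\<close>, whose zeros are counted
  fibrewise over the points of \<open>E\<close>.\<close>

lemma card_zeros_attach2:
  assumes "a \<notin> E" and "a \<noteq> i" and "A a w = 1"
  shows "card {x \<in> insert i (insert a E) \<rightarrow>\<^sub>E UNIV.
      cpoly (insert i (insert a E)) (\<lambda>T. perm2 A T (insert w R)) x = 0} +
      2 * card {x \<in> E \<rightarrow>\<^sub>E UNIV. cpoly E (\<lambda>T. perm2 A T R) x = 0} =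
    2 * 2 ^ card E + 4 * card {x \<in> E \<rightarrow>\<^sub>E UNIV.
      cpoly E (\<lambda>T. perm2 A T R) x = 0 \<and> cpoly E (\<lambda>T. perm2 A (insert a T) R) x = 0}"
    (is "?n + _ = _")
proof -
  define p where "p = cpoly E (\<lambda>T. perm2 A T R)"
  define q where "q = cpoly E (\<lambda>T. perm2 A (insert a T) R)"
  have aE: "finite (insert a E)" "i \<notin> insert a E"
    using fin(1) i(1) assms(2) by auto
  have "?n = (\<Sum>z\<in>E \<rightarrow>\<^sub>E UNIV. \<Sum>b\<in>UNIV. \<Sum>c\<in>UNIV. of_bool (b * p z + (c * p z + q z) = 0))"
    unfolding card_PiE_insert[OF aE] card_PiE_insert[OF fin(1) assms(1)]
      cpoly_insert_upd[OF aE] cpoly_insert_upd[OF fin(1) assms(1)]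
    using i assms by (simp del: sum_of_bool_eq add: card_PiE_eq_sum[OF fin(1)] sum_UNIV_bit sum.distrib cpoly_attach1 cpoly_attach2
        cpoly_attach_none cpoly_attach_root flip: p_def q_def)
  also have "\<dots> + 2 * (\<Sum>z\<in>E \<rightarrow>\<^sub>E UNIV. of_bool (p z = 0)) =
      (\<Sum>z\<in>E \<rightarrow>\<^sub>E UNIV. 2 + 4 * of_bool (p z = 0 \<and> q z = 0))"
    unfolding sum_distrib_left sum.distrib[symmetric]
  proof (rule sum.cong)
    fix z
    show "(\<Sum>b\<in>UNIV. \<Sum>c\<in>UNIV. of_bool (b * p z + (c * p z + q z) = 0)) + 2 * of_bool (p z = 0) =
        2 + (4 * of_bool (p z = 0 \<and> q z = 0) :: nat)"
      by (cases "p z"; cases "q z") (simp_all add: sum_UNIV_bit card_bit)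
  qed simp
  also have "\<dots> = 2 * 2 ^ card E + 4 * card {z \<in> E \<rightarrow>\<^sub>E UNIV. p z = 0 \<and> q z = 0}"
    by (rule sum_PiE_const_of_bool[OF fin(1)])
  finally show ?thesis
    by (simp del: sum_of_bool_eq add: card_PiE_eq_sum[OF fin(1)] p_def q_def)
qed

text \<open>In the variables of \<open>i\<close>, \<open>a\<close>, \<open>b\<close> the polynomial
  is \<open>f\<close> times the second elementary symmetric polynomial, plus a linear form with
  coefficients \<open>p + q\<close>, \<open>q\<close>, \<open>p\<close>, plus \<open>k\<close>. It
  has four zeros among the eight points of a fibre unless \<open>f\<close>, \<open>p\<close> and
  \<open>q\<close> vanish, and then eight or none.\<close>

lemma card_zeros_attach3:
  assumes "a \<notin> E" and "b \<notin> E" and "a \<noteq> i" and "b \<noteq> i" and "a \<noteq> b" and "A a w = 1" and "A b w = 1"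
  shows "card {x \<in> insert i (insert a (insert b E)) \<rightarrow>\<^sub>E UNIV.
      cpoly (insert i (insert a (insert b E))) (\<lambda>T. perm2 A T (insert w R)) x = 0} mod 8 =
    4 * (2 ^ card E + card {x \<in> E \<rightarrow>\<^sub>E UNIV. cpoly E (\<lambda>T. perm2 A T R) x = 0 \<and>
      cpoly E (\<lambda>T. perm2 A (insert a T) R) x = 0 \<and> cpoly E (\<lambda>T. perm2 A (insert b T) R) x = 0}) mod 8"
    (is "?n mod 8 = _")
proof -
  define f where "f = cpoly E (\<lambda>T. perm2 A T R)"
  define p where "p = cpoly E (\<lambda>T. perm2 A (insert a T) R)"
  define q where "q = cpoly E (\<lambda>T. perm2 A (insert b T) R)"
  define k where "k = cpoly E (\<lambda>T. perm2 A (insert i (insert a (insert b T))) (insert w R))"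
  have bE: "finite (insert b E)" "a \<notin> insert b E" and aE: "finite (insert a (insert b E))" "i \<notin> insert a (insert b E)"
    using fin(1) i(1) assms by auto
  \<comment> \<open>The added multiple of 8 makes up for the fibres without zeros, so that
    \<open>k\<close> plays no part in the residue modulo 8.\<close>
  have count: "(\<Sum>r\<in>UNIV. \<Sum>s\<in>UNIV. \<Sum>t\<in>UNIV. of_bool (r * (s * (t * 0 + f) + (t * f + (q + p))) +
      (s * (t * f + q) + (t * p + k)) = 0)) + 8 * of_bool (f = 0 \<and> p = 0 \<and> q = 0 \<and> k = 1) =
      4 + 4 * (of_bool (f = 0 \<and> p = 0 \<and> q = 0) :: nat)" for f p q k :: bit
    unfolding sum_UNIV_bit by (cases f; cases p; cases q; cases k; simp)
  let ?Q = "\<lambda>z r s t. r * (s * (t * 0 + f z) + (t * f z + (q z + p z))) +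
    (s * (t * f z + q z) + (t * p z + k z))"
  have "?n = (\<Sum>z\<in>E \<rightarrow>\<^sub>E UNIV. \<Sum>r\<in>UNIV. \<Sum>s\<in>UNIV. \<Sum>t\<in>UNIV. of_bool (?Q z r s t = 0))"
    unfolding card_PiE_insert[OF aE] card_PiE_insert[OF bE] card_PiE_insert[OF fin(1) assms(2)]
      cpoly_insert_upd[OF aE] cpoly_insert_upd[OF bE] cpoly_insert_upd[OF fin(1) assms(2)]
    using i assms by (simp del: sum_of_bool_eq add: card_PiE_eq_sum[OF fin(1)] sum_UNIV_bit sum.distrib cpoly_attach1 cpoly_attach2
        cpoly_attach_none cpoly_attach_root flip: f_def p_def q_def k_def)
  moreover have "(\<Sum>z\<in>E \<rightarrow>\<^sub>E UNIV. \<Sum>r\<in>UNIV. \<Sum>s\<in>UNIV. \<Sum>t\<in>UNIV. of_bool (?Q z r s t = 0)) +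
      8 * (\<Sum>z\<in>E \<rightarrow>\<^sub>E UNIV. of_bool (f z = 0 \<and> p z = 0 \<and> q z = 0 \<and> k z = 1)) =
      4 * 2 ^ card E + 4 * card {z \<in> E \<rightarrow>\<^sub>E UNIV. f z = 0 \<and> p z = 0 \<and> q z = 0}"
    unfolding sum_PiE_const_of_bool[OF fin(1), symmetric]
    by (subst sum_distrib_left, subst sum.distrib[symmetric], rule sum.cong[OF refl]) (rule count)
  ultimately have eq: "?n + 8 * (\<Sum>z\<in>E \<rightarrow>\<^sub>E UNIV. of_bool (f z = 0 \<and> p z = 0 \<and> q z = 0 \<and> k z = 1)) =
      4 * 2 ^ card E + 4 * card {z \<in> E \<rightarrow>\<^sub>E UNIV. f z = 0 \<and> p z = 0 \<and> q z = 0}"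
    by (simp only:)
  have "n mod 8 = m mod 8" if "n + 8 * c = m" for n m c :: nat
    using that by auto
  from this[OF eq] show ?thesis
    by (simp only: f_def p_def q_def distrib_left)
qed

end


section \<open>The matrix tree theorem modulo two\<close>

text \<open>One row of \<open>W\<close> is the sum of the others; expanding along it leaves minors
  with a repeated row.\<close>

lemma perm2_dependent_rows:
  assumes "finite S" and "finite U" and "W \<subseteq> U" and "W \<noteq> {}"
    and "\<And>e. e \<in> S \<Longrightarrow> (\<Sum>j\<in>W. A e j) = 0"
  shows "perm2 A S U = 0"
proof -
  obtain u where u: "u \<in> W"
    using assms(4) by blast
  have W: "finite W"
    using assms(2,3) finite_subset by blast
  have A: "A e u = (\<Sum>j\<in>W - {u}. A e j)" if "e \<in> S" for e
    using assms(5)[OF that] W u by (simp add: sum.remove flip: bit_eq_iff_add_eq_0)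
  have "perm2 A S (insert u (U - {u})) = (\<Sum>e\<in>S. A e u * perm2 A (S - {e}) (U - {u}))"
    using assms by (intro perm2_row) auto
  also have "\<dots> = (\<Sum>e\<in>S. \<Sum>j\<in>W - {u}. A e j * perm2 A (S - {e}) (U - {u}))"
    using A by (simp add: sum_distrib_right)
  also have "\<dots> = (\<Sum>j\<in>W - {u}. \<Sum>e\<in>S. A e j * perm2 A (S - {e}) (U - {u}))"
    by (rule sum.swap)
  also have "\<dots> = 0"
    using assms(1-3) by (intro sum.neutral ballI perm2_repeated_row) auto
  finally show ?thesis
    using u assms(3) by (simp add: insert_absorb subsetD)
qed

lemma perm2_dependent_columns:
  assumes "finite S" and "finite U" and "X \<subseteq> S" and "X \<noteq> {}"
    and "\<And>j. j \<in> U \<Longrightarrow> (\<Sum>e\<in>X. A e j) = 0"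
  shows "perm2 A S U = 0"
proof -
  obtain d where d: "d \<in> X"
    using assms(4) by blast
  have X: "finite X"
    using assms(1,3) finite_subset by blast
  have A: "A d j = (\<Sum>e\<in>X - {d}. A e j)" if "j \<in> U" for j
    using assms(5)[OF that] X d by (simp add: sum.remove flip: bit_eq_iff_add_eq_0)
  have "perm2 A (insert d (S - {d})) U = (\<Sum>j\<in>U. A d j * perm2 A (S - {d}) (U - {j}))"
    using assms by (intro perm2_column) auto
  also have "\<dots> = (\<Sum>j\<in>U. \<Sum>e\<in>X - {d}. A e j * perm2 A (S - {d}) (U - {j}))"
    using A by (simp add: sum_distrib_right)
  also have "\<dots> = (\<Sum>e\<in>X - {d}. \<Sum>j\<in>U. A e j * perm2 A (S - {d}) (U - {j}))"
    by (rule sum.swap)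
  also have "\<dots> = 0"
    using assms(1-3) by (intro sum.neutral ballI perm2_repeated_column) auto
  finally show ?thesis
    using d assms(3) by (simp add: insert_absorb subsetD)
qed

text \<open>The second conjunct makes the column of a self-loop zero, as its endpoint would count
  twice modulo two.\<close>

definition incidence :: "('v, 'e) multigraph \<Rightarrow> 'e \<Rightarrow> 'v \<Rightarrow> bit" where
  "incidence G e u = of_bool (u \<in> ends G e \<and> ends G e \<noteq> {u})"

lemma incidence_pair: "ends G e = {a, b} \<Longrightarrow> incidence G e u = of_bool (u = a) + of_bool (u = b)"
  by (auto simp: incidence_def)

lemma adjacent_sym: "adjacent G u v \<Longrightarrow> adjacent G v u"
  by (simp add: adjacent_def insert_commute)

context
  fixes G :: "('v, 'e) multigraph"
  assumes G: "finite_multigraph G"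
begin

lemma finite_verts: "finite (verts G)" and finite_edges: "finite (edges G)"
  using G by (auto simp: finite_multigraph_def)

lemma edge_cases:
  assumes "e \<in> edges G"
  obtains a b where "ends G e = {a, b}" "a \<in> verts G" "b \<in> verts G"
  using assms G by (auto simp: finite_multigraph_def)

text \<open>No edge of \<open>T\<close> leaves the component of \<open>r\<close>, so the rows of the
  vertices outside it sum to zero on \<open>T\<close>. A nonzero minor leaves no such
  vertex.\<close>

lemma perm2_incidence_connected:
  assumes T: "T \<subseteq> edges G" and r: "r \<in> verts G"
    and p: "perm2 (incidence G) T (verts G - {r}) = 1"
  shows "connected_graph (G\<lparr>edges := T\<rparr>)"
proof -
  let ?H = "G\<lparr>edges := T\<rparr>"
  define C where "C = {u. (adjacent ?H)\<^sup>*\<^sup>* r u}"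
  have "verts G - C = {}"
  proof (rule ccontr)
    assume "verts G - C \<noteq> {}"
    moreover have "(\<Sum>j\<in>verts G - C. incidence G e j) = 0" if e: "e \<in> T" for e
    proof -
      obtain a b where ab: "ends G e = {a, b}" "a \<in> verts G" "b \<in> verts G"
        using T e edge_cases by blast
      have "adjacent ?H a b" "adjacent ?H b a"
        using ab e by (auto simp: adjacent_def insert_commute)
      then have "a \<in> C \<longleftrightarrow> b \<in> C"
        unfolding C_def by (auto intro: rtranclp.rtrancl_into_rtrancl)
      moreover have "(\<Sum>j\<in>W. of_bool (j = a) :: bit) = of_bool (a \<in> W)" if "finite W" for a and W :: "'v set"
        using that by (simp add: of_bool_def)
      ultimately show ?thesis
        using ab finite_verts by (simp add: incidence_pair[OF ab(1)] sum.distrib)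
    qed
    moreover have "verts G - C \<subseteq> verts G - {r}"
      by (auto simp: C_def)
    ultimately have "perm2 (incidence G) T (verts G - {r}) = 0"
      using finite_verts finite_edges T
      by (intro perm2_dependent_rows) (auto intro: finite_subset)
    then show False
      using p by simp
  qed
  then have reach: "(adjacent ?H)\<^sup>*\<^sup>* r u" if "u \<in> verts G" for u
    using that by (auto simp: C_def)
  have "symp (adjacent ?H)"
    by (auto intro: sympI adjacent_sym)
  then have "(adjacent ?H)\<^sup>*\<^sup>* u r" if "u \<in> verts G" for u
    using reach[OF that] by (metis symp_rtranclp sympD)
  then show ?thesis
    using reach r by (auto simp: connected_graph_def intro: rtranclp_trans)
qed

text \<open>The columns along a cycle sum to zero, because each vertex of the cycle is met
  twice.\<close>

lemma perm2_incidence_acyclic: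
  assumes T: "T \<subseteq> edges G" and p: "perm2 (incidence G) T U = 1" and U: "finite U"
  shows "\<not> is_cycle (G\<lparr>edges := T\<rparr>) vs es"
proof
  assume c: "is_cycle (G\<lparr>edges := T\<rparr>) vs es"
  define n where "n = length es"
  have n: "n > 0" "length vs = n" and d: "distinct es" "set es \<subseteq> T"
    and es: "\<And>i. i < n \<Longrightarrow> ends G (es ! i) = {vs ! i, vs ! (Suc i mod n)}"
    using c by (auto simp: is_cycle_def n_def)
  have "(\<Sum>e\<in>set es. incidence G e j) = 0" for j
  proof -
    have "(\<Sum>e\<in>set es. incidence G e j) = (\<Sum>i<n. incidence G (es ! i) j)"
      using d(1) by (intro sum.reindex_bij_betw[symmetric]) (simp add: bij_betw_nth n_def)
    also have "\<dots> = (\<Sum>i<n. of_bool (j = vs ! i)) + (\<Sum>i<n. of_bool (j = vs ! (Suc i mod n)))"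
      using es by (simp add: incidence_pair sum.distrib)
    \<comment> \<open>The cyclic shift only permutes the vertices of the cycle; for a self-loop it
      is the identity.\<close>
    also have "(\<Sum>i<n. of_bool (j = vs ! (Suc i mod n)) :: bit) = (\<Sum>i<n. of_bool (j = vs ! i))"
    proof -
      obtain m where m: "n = Suc m"
        using n(1) gr0_implies_Suc by blast
      have "(\<Sum>i<Suc m. of_bool (j = vs ! (Suc i mod Suc m)) :: bit) =
          (\<Sum>i<m. of_bool (j = vs ! Suc i)) + of_bool (j = vs ! 0)"
        by simp
      also have "\<dots> = (\<Sum>i<Suc m. of_bool (j = vs ! i))"
        by (simp only: sum.lessThan_Suc_shift add.commute)
      finally show ?thesis
        by (simp only: m)
    qed
    finally show ?thesis
      by simp
  qed
  moreover have "finite T" "set es \<noteq> {}"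
    using T finite_edges finite_subset n by (auto simp: n_def)
  ultimately have "perm2 (incidence G) T U = 0"
    using d(2) U by (intro perm2_dependent_columns) auto
  then show False
    using p by simp
qed

text \<open>A path is extended at its start; if the new vertex already lies on it, the path is cut
  off there instead.\<close>

lemma simple_path:
  assumes S: "S \<subseteq> edges G" and "(adjacent (G\<lparr>edges := S\<rparr>))\<^sup>*\<^sup>* x y" and "y \<in> verts G"
  shows "\<exists>vs es. vs \<noteq> [] \<and> hd vs = x \<and> last vs = y \<and> distinct vs \<and> set vs \<subseteq> verts G \<and>
    length vs = Suc (length es) \<and> set es \<subseteq> S \<and>
    (\<forall>i<length es. ends G (es ! i) = {vs ! i, vs ! Suc i})"
  using assms(2)
proof (induction rule: converse_rtranclp_induct)
  case base
  show ?case
    by (rule exI[of _ "[y]"], rule exI[of _ "[]"]) (use assms(3) in simp)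
next
  case (step x z)
  obtain e where e: "e \<in> S" "ends G e = {x, z}"
    using step(1) by (auto simp: adjacent_def)
  then have x: "x \<in> verts G"
    using S edge_cases[of e] by (metis doubleton_eq_iff subsetD)
  obtain vs es where p: "vs \<noteq> []" "hd vs = z" "last vs = y" "distinct vs" "set vs \<subseteq> verts G"
    "length vs = Suc (length es)" "set es \<subseteq> S" "\<forall>i<length es. ends G (es ! i) = {vs ! i, vs ! Suc i}"
    using step.IH by blast
  show ?case
  proof (cases "x \<in> set vs")
    case False
    have "ends G ((e # es) ! i) = {(x # vs) ! i, (x # vs) ! Suc i}" if "i < length (e # es)" for i
      using that p(1,2,8) e(2) by (cases i) (auto simp: hd_conv_nth)
    then show ?thesis
      using p e(1) False x by (intro exI[of _ "x # vs"] exI[of _ "e # es"]) auto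
  next
    case True
    then obtain k where k: "k < length vs" "vs ! k = x"
      by (auto simp: in_set_conv_nth)
    have "set (drop k vs) \<subseteq> verts G" "set (drop k es) \<subseteq> S"
      using p(5,7) set_drop_subset by fast+
    then show ?thesis
      using p k by (intro exI[of _ "drop k vs"] exI[of _ "drop k es"]) (auto simp: hd_drop_conv_nth)
  qed
qed

text \<open>A simple path in \<open>S\<close> between the ends of \<open>e\<close> is closed by
  \<open>e\<close>. For a self-loop the path is a single vertex.\<close>

lemma cycle_through_edge:
  assumes S: "S \<subseteq> edges G" and "connected_graph (G\<lparr>edges := S\<rparr>)" and e: "e \<in> edges G" "e \<notin> S"
  shows "\<exists>vs es. is_cycle (G\<lparr>edges := insert e S\<rparr>) vs es"
proof -
  obtain a b where ab: "ends G e = {a, b}" "a \<in> verts G" "b \<in> verts G"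
    using e edge_cases by blast
  have "(adjacent (G\<lparr>edges := S\<rparr>))\<^sup>*\<^sup>* a b"
    using assms(2) ab by (auto simp: connected_graph_def)
  then obtain vs es where p: "vs \<noteq> []" "hd vs = a" "last vs = b" "distinct vs" "set vs \<subseteq> verts G"
    "length vs = Suc (length es)" "set es \<subseteq> S" "\<forall>i<length es. ends G (es ! i) = {vs ! i, vs ! Suc i}"
    using simple_path[OF S _ ab(3)] by blast
  \<comment> \<open>A repeated edge would make two vertices at different positions of the path
    equal.\<close>
  have "distinct es"
  proof (rule ccontr)
    assume "\<not> distinct es"
    then obtain i j where ij: "i < length es" "j < length es" "i < j" "es ! i = es ! j"
      by (metis distinct_conv_nth linorder_neqE_nat)
    then have "{vs ! i, vs ! Suc i} = {vs ! j, vs ! Suc j}"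
      using p(8) by metis
    then have "vs ! i = vs ! j \<or> vs ! i = vs ! Suc j"
      by (metis insertE insertI1 singletonD)
    then show False
      using p(4,6) ij by (auto simp: nth_eq_iff_index_eq)
  qed
  moreover have "ends G ((es @ [e]) ! i) = {vs ! i, vs ! (Suc i mod length vs)}" if "i < length (es @ [e])" for i
  proof (cases "i = length es")
    case True
    then have "vs ! i = b" "vs ! (Suc i mod length vs) = a"
      using p(1-3,6) by (simp_all add: last_conv_nth hd_conv_nth)
    then show ?thesis
      using True ab(1) by auto
  next
    case False
    then show ?thesis
      using that p(6,8) by (simp add: nth_append)
  qed
  ultimately have "is_cycle (G\<lparr>edges := insert e S\<rparr>) vs (es @ [e])"
    using p e(2) by (auto simp: is_cycle_def)
  then show ?thesis
    by blast
qed

text \<open>A vertex set \<open>U\<close> grows from \<open>{r}\<close>, each time by an edge of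
  \<open>T\<close> leaving it, while the minor of the chosen edges stays nonzero.\<close>

lemma connected_perm2_incidence:
  assumes T: "T \<subseteq> edges G" and r: "r \<in> verts G" and c: "connected_graph (G\<lparr>edges := T\<rparr>)"
  shows "\<exists>S\<subseteq>T. perm2 (incidence G) S (verts G - {r}) = 1"
proof -
  let ?H = "G\<lparr>edges := T\<rparr>"
  have "\<exists>U S. U \<subseteq> verts G \<and> card U = Suc n \<and> r \<in> U \<and> S \<subseteq> T \<and> (\<forall>e\<in>S. ends G e \<subseteq> U) \<and>
      perm2 (incidence G) S (U - {r}) = 1" if "Suc n \<le> card (verts G)" for n
    using that
  proof (induction n)
    case 0
    show ?case
      by (rule exI[of _ "{r}"], rule exI[of _ "{}"]) (use r in \<open>simp add: perm2_empty\<close>)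
  next
    case (Suc n)
    then obtain U S where U: "U \<subseteq> verts G" "card U = Suc n" "r \<in> U" and S: "S \<subseteq> T" "\<forall>e\<in>S. ends G e \<subseteq> U"
      and p: "perm2 (incidence G) S (U - {r}) = 1"
      by (auto simp: Suc_le_eq dest: Suc_lessD)
    have fin: "finite U" "finite S"
      using U(1) S(1) T finite_verts finite_edges by (meson finite_subset)+
    have "U \<noteq> verts G"
      using U(2) Suc.prems by auto
    then obtain z where z: "z \<in> verts G" "z \<notin> U"
      using U(1) by blast
    have "(adjacent ?H)\<^sup>*\<^sup>* r z"
      using c r z(1) by (simp add: connected_graph_def)
    then have "z \<notin> U \<Longrightarrow> \<exists>u v. u \<in> U \<and> v \<notin> U \<and> adjacent ?H u v"
      by (induction rule: rtranclp_induct) (use U(3) in blast)+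
    then obtain u v e where uv: "u \<in> U" "v \<notin> U" "e \<in> T" "ends G e = {u, v}"
      using z(2) by (auto simp: adjacent_def)
    have v: "v \<in> verts G"
      using uv T edge_cases[of e] by (metis doubleton_eq_iff subsetD)
    have "e \<notin> S"
      using S(2) uv by auto
    have "insert v U - {r} = insert v (U - {r})"
      using uv U(3) by auto
    then have "perm2 (incidence G) (insert e S) (insert v U - {r}) =
        (\<Sum>d\<in>insert e S. incidence G d v * perm2 (incidence G) (insert e S - {d}) (U - {r}))"
      using fin uv(2) by (simp only:) (intro perm2_row, auto)
    \<comment> \<open>The edges chosen before stay inside \<open>U\<close>, so in the row of the new
      vertex \<open>v\<close> only \<open>e\<close> has an entry.\<close>
    also have "\<dots> = (\<Sum>d\<in>{e}. incidence G d v * perm2 (incidence G) (insert e S - {d}) (U - {r}))"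
      using fin S(2) uv(2) by (intro sum.mono_neutral_right) (auto simp: incidence_def)
    also have "\<dots> = 1"
      using p uv \<open>e \<notin> S\<close> by (auto simp: incidence_def)
    finally have "perm2 (incidence G) (insert e S) (insert v U - {r}) = 1" .
    moreover have "card (insert v U) = Suc (Suc n)"
      using fin U(2) uv(2) by simp
    ultimately show ?case
      using U v S uv by (intro exI[of _ "insert v U"] exI[of _ "insert e S"]) auto
  qed
  note grow = this
  have "card (verts G) > 0"
    using r finite_verts by (auto simp: card_gt_0_iff)
  then obtain n where n: "card (verts G) = Suc n"
    using gr0_implies_Suc by blast
  then obtain U S where "U \<subseteq> verts G" "card U = card (verts G)" "S \<subseteq> T" "perm2 (incidence G) S (U - {r}) = 1"
    using grow[of n] by auto
  then show ?thesis
    using card_subset_eq[OF finite_verts] by blast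
qed

text \<open>A nonzero minor gives connectedness and excludes cycles. Conversely, a spanning tree
  \<open>T\<close> contains a set \<open>S\<close> with nonzero minor, and an edge of
  \<open>T\<close> outside the connected \<open>S\<close> would close a cycle.\<close>

lemma perm2_incidence_spanning_tree:
  assumes T: "T \<subseteq> edges G" and r: "r \<in> verts G"
  shows "perm2 (incidence G) T (verts G - {r}) = of_bool (T \<in> spanning_trees G)"
proof (cases "perm2 (incidence G) T (verts G - {r}) = 1")
  case True
  then have "is_tree (G\<lparr>edges := T\<rparr>)"
    using perm2_incidence_connected[OF T r True] perm2_incidence_acyclic[OF T True] finite_verts
    by (auto simp: is_tree_def)
  then show ?thesis
    using True T by (simp add: spanning_trees_def)
next
  case False
  have "T \<notin> spanning_trees G"
  proof
    assume "T \<in> spanning_trees G"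
    then have t: "connected_graph (G\<lparr>edges := T\<rparr>)" "\<And>vs es. \<not> is_cycle (G\<lparr>edges := T\<rparr>) vs es"
      by (auto simp: spanning_trees_def is_tree_def)
    obtain S where S: "S \<subseteq> T" "perm2 (incidence G) S (verts G - {r}) = 1"
      using connected_perm2_incidence[OF T r t(1)] by blast
    then have "S \<noteq> T"
      using False by metis
    then obtain e where e: "e \<in> T" "e \<notin> S"
      using S(1) by blast
    have "S \<subseteq> edges G"
      using S(1) T by blast
    then obtain vs es where "is_cycle (G\<lparr>edges := insert e S\<rparr>) vs es"
      using cycle_through_edge perm2_incidence_connected[OF _ r S(2)] e T by blast
    then have "is_cycle (G\<lparr>edges := T\<rparr>) vs es"
      using e S(1) by (auto simp: is_cycle_def)
    then show False
      using t(2) by blast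
  qed
  then show ?thesis
    using False by simp
qed

lemma kirchhoff_eq_cpoly:
  assumes "r \<in> verts G"
  shows "kirchhoff G x = cpoly (edges G) (\<lambda>T. perm2 (incidence G) T (verts G - {r})) x"
proof -
  have "cpoly (edges G) (\<lambda>T. perm2 (incidence G) T (verts G - {r})) x =
      (\<Sum>T\<in>Pow (edges G). of_bool (T \<in> spanning_trees G) * (\<Prod>e\<in>edges G - T. x e))"
    unfolding cpoly_def using assms by (intro sum.cong) (auto simp: perm2_incidence_spanning_tree)
  also have "\<dots> = (\<Sum>T\<in>spanning_trees G. of_bool (T \<in> spanning_trees G) * (\<Prod>e\<in>edges G - T. x e))"
    using finite_edges by (intro sum.mono_neutral_right) (auto simp: spanning_trees_def)
  finally show ?thesis
    by (simp add: kirchhoff_def)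
qed

end


section \<open>Deleting a vertex of a triangle\<close>

definition core :: "('v, 'e) multigraph \<Rightarrow> 'v \<Rightarrow> 'v \<Rightarrow> 'e set" where
  "core G v w = {e \<in> edges G. v \<notin> ends G e \<and> w \<notin> ends G e}"

text \<open>Together with \<open>core G v w\<close> these are the edges that remain when
  \<open>v\<close> is deleted, self-loops at \<open>w\<close> included.\<close>

definition star :: "('v, 'e) multigraph \<Rightarrow> 'v \<Rightarrow> 'v \<Rightarrow> 'e set" where
  "star G v w = {e \<in> edges G. v \<notin> ends G e \<and> w \<in> ends G e}"

definition between :: "('v, 'e) multigraph \<Rightarrow> 'v \<Rightarrow> 'v \<Rightarrow> 'e set" where
  "between G v w = {e \<in> edges G. ends G e = {v, w}}"

lemma core_commute: "core G w v = core G v w"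
  by (auto simp: core_def)

lemma between_commute: "between G w v = between G v w"
  by (simp add: between_def insert_commute)

locale triangle =
  fixes G :: "('v, 'e) multigraph" and v w c :: 'v
  assumes G: "finite_multigraph G" and regular: "regular 4 G"
    and verts: "v \<in> verts G" "w \<in> verts G" "c \<in> verts G"
    and neq: "v \<noteq> w" "c \<noteq> v" "c \<noteq> w"
    and adj: "adjacent G v w" "adjacent G c v" "adjacent G c w"
begin

lemma triangle_commute: "triangle G w v c"
  using G regular verts neq adj adjacent_sym by unfold_locales auto

text \<open>The rows of the reduced incidence matrix of \<open>G\<close> without \<open>v\<close>
  and \<open>w\<close>, with \<open>c\<close> as the omitted root.\<close>

abbreviation "R \<equiv> verts G - {v, w, c}"
abbreviation "K \<equiv> core G v w"
abbreviation "A \<equiv> incidence G"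

lemma fin [simp]: "finite (verts G)" "finite (edges G)" "finite K" "finite (star G x y)" "finite (between G x y)"
  using finite_verts[OF G] finite_edges[OF G] by (auto simp: core_def star_def between_def)

lemma degree_4: "u \<in> verts G \<Longrightarrow> card {e \<in> edges G. u \<in> ends G e} + card {e \<in> edges G. ends G e = {u}} = 4"
  using regular by (simp add: regular_def degree_def)

text \<open>The row of \<open>c\<close> is the one omitted, so that an edge between \<open>c\<close>
  and \<open>w\<close> has its only entry at \<open>w\<close>.\<close>

lemma point_count_delete:
  "point_count TYPE(bit) (delete_vertex G v) = card {x \<in> K \<union> star G v w \<rightarrow>\<^sub>E UNIV.
    cpoly (K \<union> star G v w) (\<lambda>T. perm2 A T (insert w R)) x = 0}"
proof -
  let ?H = "delete_vertex G v"
  have H: "finite_multigraph ?H"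
    unfolding finite_multigraph_def
  proof (intro conjI ballI)
    fix e assume "e \<in> edges ?H"
    then have e: "e \<in> edges G" "v \<notin> ends G e"
      by (auto simp: delete_vertex_def)
    obtain a b where ab: "ends G e = {a, b}" "a \<in> verts G" "b \<in> verts G"
      by (rule edge_cases[OF G e(1)])
    then have "a \<in> verts ?H" "b \<in> verts ?H"
      using e(2) unfolding ab(1) by (auto simp: delete_vertex_def)
    moreover have "ends ?H e = {a, b}"
      using ab(1) by (simp add: delete_vertex_def)
    ultimately show "\<exists>a\<in>verts ?H. \<exists>b\<in>verts ?H. ends ?H e = {a, b}"
      by blast
  qed (simp_all add: delete_vertex_def)
  have E: "edges ?H = K \<union> star G v w"
    by (auto simp: delete_vertex_def core_def star_def)
  have V: "c \<in> verts ?H" "verts ?H - {c} = insert w R"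
    using verts neq by (auto simp: delete_vertex_def)
  have A: "incidence ?H = A"
    by (simp add: fun_eq_iff incidence_def delete_vertex_def)
  show ?thesis
    by (simp only: point_count_def kirchhoff_eq_cpoly[OF H V(1)] E V(2) A)
qed

lemma incidence_root [simp]: "ends G i = {c, w} \<Longrightarrow> A i w = 1" "ends G i = {c, w} \<Longrightarrow> j \<in> R \<Longrightarrow> A i j = 0"
  using neq by (auto simp: incidence_def)

lemma incidence_core: "e \<in> K \<Longrightarrow> A e w = 0"
  by (simp add: core_def incidence_def)

lemma incidence_star: "e \<in> star G v w \<Longrightarrow> ends G e \<noteq> {w} \<Longrightarrow> A e w = 1"
  by (simp add: star_def incidence_def)

lemma star_disjoint: "e \<in> star G v w \<Longrightarrow> e \<notin> K" "e \<in> star G w v \<Longrightarrow> e \<notin> K"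
  by (auto simp: core_def star_def)

lemma edges_decomp: "edges G = K \<union> star G v w \<union> star G w v \<union> between G v w"
proof -
  have "ends G e = {v, w}" if e: "e \<in> edges G" "v \<in> ends G e" "w \<in> ends G e" for e
  proof -
    obtain a b where "ends G e = {a, b}"
      by (rule edge_cases[OF G e(1)])
    then show ?thesis
      using e(2,3) neq(1) by auto
  qed
  then show ?thesis
    unfolding core_def star_def between_def by blast
qed

text \<open>The degree of \<open>j\<close> is even and self-loops have zero columns, so the row of
  \<open>j\<close> sums to zero over all edges of \<open>G\<close>; edges between \<open>v\<close>
  and \<open>w\<close> have no entry in it.\<close>

lemma incidence_sum_core:
  assumes j: "j \<in> R"
  shows "(\<Sum>e\<in>K. A e j) = (\<Sum>e\<in>star G v w. A e j) + (\<Sum>e\<in>star G w v. A e j)"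
proof -
  let ?l = "{e \<in> edges G. ends G e = {j}}"
  have "{e \<in> edges G. j \<in> ends G e} = {e \<in> edges G. j \<in> ends G e \<and> ends G e \<noteq> {j}} \<union> ?l"
    by auto
  then have "card {e \<in> edges G. j \<in> ends G e} =
      card {e \<in> edges G. j \<in> ends G e \<and> ends G e \<noteq> {j}} + card ?l"
    by (simp only:) (rule card_Un_disjoint, auto)
  moreover have "card {e \<in> edges G. j \<in> ends G e} + card ?l = 4"
    using degree_4[of j] j by blast
  ultimately have even: "even (card {e \<in> edges G. j \<in> ends G e \<and> ends G e \<noteq> {j}})"
    by presburger
  have "edges G \<inter> {e. j \<in> ends G e \<and> ends G e \<noteq> {j}} = {e \<in> edges G. j \<in> ends G e \<and> ends G e \<noteq> {j}}"
    by blast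
  then have "(\<Sum>e\<in>edges G. A e j) = 0"
    using even by (simp only: incidence_def sum_of_bool_eq fin bit_of_nat_eq_0_iff)
  moreover have "(\<Sum>e\<in>edges G. A e j) =
      (\<Sum>e\<in>K. A e j) + (\<Sum>e\<in>star G v w. A e j) + (\<Sum>e\<in>star G w v. A e j) + (\<Sum>e\<in>between G v w. A e j)"
    unfolding edges_decomp
    by ((subst sum.union_disjoint, simp, simp, force simp: core_def star_def between_def)+) simp
  moreover have "(\<Sum>e\<in>between G v w. A e j) = 0"
    using j by (intro sum.neutral) (auto simp: between_def incidence_def)
  ultimately show ?thesis
    by (subst bit_eq_iff_add_eq_0) (simp add: add.assoc)
qed

lemma incidence_sum_row:
  assumes "e \<in> K \<or> e \<in> star G v w \<and> ends G e \<noteq> {w} \<or> e \<in> star G w v \<and> ends G e \<noteq> {v}"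
  shows "(\<Sum>j\<in>R. A e j) = of_bool (if e \<in> K then c \<in> ends G e \<and> ends G e \<noteq> {c} else c \<notin> ends G e)"
proof -
  have "e \<in> edges G"
    using assms by (auto simp: core_def star_def)
  obtain a b where ab: "ends G e = {a, b}" "a \<in> verts G" "b \<in> verts G"
    by (rule edge_cases[OF G \<open>e \<in> edges G\<close>])
  have "(\<Sum>j\<in>R. of_bool (j = x) :: bit) = of_bool (x \<in> R)" for x
    by (simp add: of_bool_def)
  then have "(\<Sum>j\<in>R. A e j) = of_bool (a \<in> R) + of_bool (b \<in> R)"
    by (simp add: incidence_pair[OF ab(1)] sum.distrib)
  then show ?thesis
    using assms ab neq by (auto simp: core_def star_def of_bool_def split: if_splits)
qed

text \<open>The degree of \<open>c\<close> bounds the edges at it, of which at least one goes to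
  \<open>v\<close> and one to \<open>w\<close>.\<close>

lemma card_core_root:
  obtains i j where "i \<in> star G v w" "ends G i = {c, w}" "j \<in> star G w v" "ends G j = {c, v}"
    "card {e \<in> K. c \<in> ends G e} + card {e \<in> star G v w. c \<in> ends G e} + card {e \<in> star G w v. c \<in> ends G e} \<le> 4"
proof -
  obtain i j where ij: "i \<in> edges G" "ends G i = {c, w}" "j \<in> edges G" "ends G j = {c, v}"
    using adj by (auto simp: adjacent_def)
  have "card ({e \<in> K. c \<in> ends G e} \<union> {e \<in> star G v w. c \<in> ends G e} \<union> {e \<in> star G w v. c \<in> ends G e}) =
      card {e \<in> K. c \<in> ends G e} + card {e \<in> star G v w. c \<in> ends G e} + card {e \<in> star G w v. c \<in> ends G e}"
    by (subst card_Un_disjoint, simp, simp, force simp: core_def star_def)+ simp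
  moreover have "card ({e \<in> K. c \<in> ends G e} \<union> {e \<in> star G v w. c \<in> ends G e} \<union> {e \<in> star G w v. c \<in> ends G e})
      \<le> card {e \<in> edges G. c \<in> ends G e}"
    by (rule card_mono) (auto simp: core_def star_def)
  ultimately show ?thesis
    using that[of i j] ij neq degree_4[OF verts(3)] by (auto simp: star_def)
qed

text \<open>The odd columns of \<open>K\<close> are edges at \<open>c\<close>, and the edges to
  \<open>v\<close> and \<open>w\<close> leave room for two. If there are two, \<open>i\<close> is
  the only edge joining \<open>w\<close> to \<open>c\<close>, so any other non-loop edge of the star
  has its far end in \<open>R\<close>.\<close>

lemma few_odd:
  assumes "card R \<ge> 2"
  shows "few_odd_columns A K R"
    and "e \<in> star G v w \<Longrightarrow> ends G e \<noteq> {w} \<Longrightarrow> e \<noteq> i \<Longrightarrow> i \<in> star G v w \<Longrightarrow> c \<in> ends G i \<Longrightarrow>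
      card {e \<in> K. (\<Sum>j\<in>R. A e j) = 1} = 2 \<Longrightarrow> (\<Sum>j\<in>R. A e j) = 1"
proof -
  let ?C = "{e \<in> K. (\<Sum>j\<in>R. A e j) = 1}"
  have "?C \<subseteq> {e \<in> K. c \<in> ends G e}"
    by (auto simp: incidence_sum_row)
  then have C: "card ?C \<le> card {e \<in> K. c \<in> ends G e}"
    by (intro card_mono) auto
  obtain i' j' where ij: "i' \<in> star G v w" "ends G i' = {c, w}" "j' \<in> star G w v" "ends G j' = {c, v}"
    and le: "card {e \<in> K. c \<in> ends G e} + card {e \<in> star G v w. c \<in> ends G e} + card {e \<in> star G w v. c \<in> ends G e} \<le> 4"
    by (rule card_core_root)
  have pos: "card {e \<in> star G v w. c \<in> ends G e} > 0" "card {e \<in> star G w v. c \<in> ends G e} > 0"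
    using ij by (auto simp: card_gt_0_iff)
  show "few_odd_columns A K R"
    using assms C le pos by unfold_locales auto
  assume e: "e \<in> star G v w" "ends G e \<noteq> {w}" "e \<noteq> i" "i \<in> star G v w" "c \<in> ends G i" "card ?C = 2"
  have "c \<notin> ends G e"
  proof
    assume "c \<in> ends G e"
    then have "card {e, i} \<le> card {e \<in> star G v w. c \<in> ends G e}"
      using e by (intro card_mono) auto
    then show False
      using e C le pos by simp
  qed
  then show "(\<Sum>j\<in>R. A e j) = 1"
    using e(1,2) star_disjoint(1)[OF e(1)] by (subst incidence_sum_row) auto
qed

text \<open>An edge to \<open>c\<close> and one to \<open>v\<close> use two of the four ends at
  \<open>w\<close>, and a self-loop uses two. The multiplicity of the edge between \<open>v\<close>
  and \<open>w\<close> is recorded because the cases at \<open>v\<close> and at \<open>w\<close>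
  share it.\<close>

lemma star_cases:
  obtains
    (one) i where "ends G i = {c, w}" "star G v w = {i}" "card (between G v w) = 3"
  | (two) i a where "ends G i = {c, w}" "star G v w = {i, a}" "i \<noteq> a" "ends G a \<noteq> {w}" "card (between G v w) = 2"
  | (three) i a b where "ends G i = {c, w}" "star G v w = {i, a, b}" "i \<noteq> a" "i \<noteq> b" "a \<noteq> b"
      "ends G a \<noteq> {w}" "ends G b \<noteq> {w}" "card (between G v w) = 1"
  | (loop) i l where "ends G i = {c, w}" "star G v w = {i, l}" "i \<noteq> l" "ends G l = {w}" "card (between G v w) = 1"
proof -
  let ?S = "star G v w" and ?L = "{e \<in> edges G. ends G e = {w}}" and ?B = "between G v w"
  obtain i where i: "i \<in> ?S" "ends G i = {c, w}"
    by (rule card_core_root) blast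
  have "{e \<in> edges G. w \<in> ends G e} = ?S \<union> ?B"
    using edges_decomp by (auto simp: star_def between_def core_def)
  moreover have "?S \<inter> ?B = {}"
    by (auto simp: star_def between_def)
  ultimately have sum: "card ?S + card ?B + card ?L = 4"
    using degree_4[OF verts(2)] by (simp add: card_Un_disjoint)
  have B: "card ?B > 0"
    using adj(1) by (auto simp: card_gt_0_iff between_def adjacent_def)
  have L: "?L \<subseteq> ?S - {i}"
  proof
    fix e assume e: "e \<in> ?L"
    then have "e \<noteq> i"
      using i(2) neq(3) by (metis (mono_tags) insertI1 mem_Collect_eq singletonD)
    then show "e \<in> ?S - {i}"
      using e neq(1) by (simp add: star_def)
  qed
  have S: "card ?S = Suc (card (?S - {i}))"
    by (rule card.remove[OF fin(4) i(1)])
  have LS: "card ?L \<le> card (?S - {i})"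
    using L by (intro card_mono) auto
  have S': "?S = insert i (?S - {i})"
    using i(1) by blast
  consider "card (?S - {i}) = 0" "card ?L = 0" "card ?B = 3" | "card (?S - {i}) = 1" "card ?L = 0" "card ?B = 2"
    | "card (?S - {i}) = 2" "card ?L = 0" "card ?B = 1" | "card (?S - {i}) = 1" "card ?L = 1" "card ?B = 1"
    using sum B S LS by linarith
  then show ?thesis
  proof cases
    case 1
    then have "?S - {i} = {}"
      by (simp only: card_0_eq finite_Diff fin)
    then have "?S = {i}"
      using S' by (simp only:)
    then show ?thesis
      by (rule one[OF i(2) _ 1(3)])
  next
    case 2
    then obtain a where a: "?S - {i} = {a}"
      by (auto simp: card_1_singleton_iff)
    have "?S = {i, a}"
      using S' a by (simp only:)
    moreover have "i \<noteq> a" "a \<in> ?S"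
      using a by blast+
    moreover have "ends G a \<noteq> {w}"
      using 2(2) \<open>a \<in> ?S\<close> by (auto simp: star_def)
    ultimately show ?thesis
      by (intro two[OF i(2) _ _ _ 2(3)])
  next
    case 3
    then obtain a b where ab: "?S - {i} = {a, b}" "a \<noteq> b"
      by (auto simp: card_2_iff)
    have "?S = {i, a, b}"
      using S' ab(1) by (simp only:)
    moreover have "i \<noteq> a" "i \<noteq> b" "a \<in> ?S" "b \<in> ?S"
      using ab(1) by blast+
    moreover have "ends G a \<noteq> {w}" "ends G b \<noteq> {w}"
      using 3(2) \<open>a \<in> ?S\<close> \<open>b \<in> ?S\<close> by (auto simp: star_def)
    ultimately show ?thesis
      using ab(2) by (intro three[OF i(2) _ _ _ _ _ _ 3(3)])
  next
    case 4
    then obtain l l' where l: "?S - {i} = {l}" "?L = {l'}"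
      by (auto simp: card_1_singleton_iff)
    have "l' \<in> ?L"
      unfolding l(2) by simp
    moreover have "l' = l"
      using L unfolding l by simp
    ultimately have "ends G l = {w}"
      by simp
    moreover have "?S = {i, l}"
      using S' l(1) by (simp only:)
    moreover have "i \<noteq> l"
      using l(1) by blast
    ultimately show ?thesis
      by (intro loop[OF i(2) _ _ _ 4(3)])
  qed
qed

text \<open>With fewer than two edges in \<open>K\<close>, a vertex of \<open>R\<close> without a
  self-loop would meet at most three edges. Hence each vertex of \<open>R\<close> carries a
  self-loop, and two such vertices already give two edges in \<open>K\<close>.\<close>

lemma card_core_ge_2:
  assumes "card R \<ge> 2" and "\<And>e. e \<in> star G w v \<Longrightarrow> ends G e \<inter> R = {}"
    and "card {e \<in> star G v w. ends G e \<inter> R \<noteq> {}} \<le> 2"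
  shows "card K \<ge> 2"
proof (rule ccontr)
  assume K: "\<not> card K \<ge> 2"
  have loop: "\<exists>e\<in>K. ends G e = {u}" if u: "u \<in> R" for u
  proof (rule ccontr)
    assume "\<not> (\<exists>e\<in>K. ends G e = {u})"
    then have "{e \<in> edges G. ends G e = {u}} = {}"
      using u by (auto simp: core_def)
    then have "4 = card {e \<in> edges G. u \<in> ends G e}"
      using degree_4[of u] u by (simp only: card.empty) simp
    also have "\<dots> \<le> card (K \<union> {e \<in> star G v w. ends G e \<inter> R \<noteq> {}})"
    proof (rule card_mono)
      show "{e \<in> edges G. u \<in> ends G e} \<subseteq> K \<union> {e \<in> star G v w. ends G e \<inter> R \<noteq> {}}"
        using assms(2) u edges_decomp by (auto simp: between_def)
    qed simp
    also have "\<dots> \<le> card K + card {e \<in> star G v w. ends G e \<inter> R \<noteq> {}}"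
      by (rule card_Un_le)
    finally show False
      using K assms(3) by linarith
  qed
  obtain u1 u2 where u: "u1 \<in> R" "u2 \<in> R" "u1 \<noteq> u2"
    using assms(1) by (metis card_le_Suc0_iff_eq fin(1) finite_Diff not_less_eq_eq numeral_2_eq_2)
  obtain e1 e2 where e: "e1 \<in> K" "ends G e1 = {u1}" "e2 \<in> K" "ends G e2 = {u2}"
    using loop u by meson
  then have "e1 \<noteq> e2"
    using u(3) by auto
  then have "card {e1, e2} = 2"
    by simp
  moreover have "card {e1, e2} \<le> card K"
    using e by (intro card_mono) auto
  ultimately show False
    using K by simp
qed

abbreviation "zeros \<equiv> card {x \<in> K \<rightarrow>\<^sub>E UNIV. cpoly K (\<lambda>T. perm2 A T R) x = 0}"

lemma attach_root:
  assumes "ends G i = {c, w}" and "i \<in> star G v w"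
  shows "w \<notin> R" "i \<notin> K" "A i w = 1" "\<And>j. j \<in> R \<Longrightarrow> A i j = 0"
  using assms star_disjoint by auto

lemma point_count_one:
  assumes "ends G i = {c, w}" and "star G v w = {i}"
  shows "point_count TYPE(bit) (delete_vertex G v) = 2 * zeros"
proof -
  have i: "i \<in> star G v w" and eq: "K \<union> star G v w = insert i K"
    using assms(2) by auto
  note r = attach_root[OF assms(1) i]
  show ?thesis
    unfolding point_count_delete eq
    by (rule card_zeros_attach1) (use r incidence_core in auto)
qed

lemma point_count_loop:
  assumes "ends G i = {c, w}" and "star G v w = {i, l}" and "i \<noteq> l" and "ends G l = {w}"
  shows "point_count TYPE(bit) (delete_vertex G v) = 2 * (2 ^ card K + zeros)"
proof -
  have i: "i \<in> star G v w" and l: "l \<in> star G v w" and eq: "K \<union> star G v w = insert i (insert l K)"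
    using assms(2) by auto
  note r = attach_root[OF assms(1) i]
  show ?thesis
    unfolding point_count_delete eq
    by (rule card_zeros_attach_loop)
      (use r incidence_core assms(3,4) star_disjoint(1)[OF l] in \<open>auto simp: incidence_def\<close>)
qed

lemma point_count_two:
  assumes "ends G i = {c, w}" and "star G v w = {i, a}" and "i \<noteq> a" and "ends G a \<noteq> {w}"
  shows "point_count TYPE(bit) (delete_vertex G v) + 2 * zeros = 2 * 2 ^ card K +
    4 * card {x \<in> K \<rightarrow>\<^sub>E UNIV. cpoly K (\<lambda>T. perm2 A T R) x = 0 \<and> cpoly K (\<lambda>T. perm2 A (insert a T) R) x = 0}"
proof -
  have i: "i \<in> star G v w" and a: "a \<in> star G v w" and eq: "K \<union> star G v w = insert i (insert a K)"
    using assms(2) by auto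
  note r = attach_root[OF assms(1) i]
  show ?thesis
    unfolding point_count_delete eq
    by (rule card_zeros_attach2)
      (use r incidence_core assms(3) star_disjoint(1)[OF a] incidence_star[OF a assms(4)] in auto)
qed

lemma point_count_three:
  assumes "ends G i = {c, w}" and "star G v w = {i, a, b}" and "i \<noteq> a" and "i \<noteq> b" and "a \<noteq> b"
    and "ends G a \<noteq> {w}" and "ends G b \<noteq> {w}"
  shows "point_count TYPE(bit) (delete_vertex G v) mod 8 = 4 * (2 ^ card K +
    card {x \<in> K \<rightarrow>\<^sub>E UNIV. cpoly K (\<lambda>T. perm2 A T R) x = 0 \<and>
      cpoly K (\<lambda>T. perm2 A (insert a T) R) x = 0 \<and> cpoly K (\<lambda>T. perm2 A (insert b T) R) x = 0}) mod 8"
proof -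
  have i: "i \<in> star G v w" and a: "a \<in> star G v w" and b: "b \<in> star G v w"
    and eq: "K \<union> star G v w = insert i (insert a (insert b K))"
    using assms(2) by auto
  note r = attach_root[OF assms(1) i]
  show ?thesis
    unfolding point_count_delete eq
    by (rule card_zeros_attach3)
      (use r incidence_core assms(3-5) star_disjoint(1)[OF a] incidence_star[OF a assms(6)]
        star_disjoint(1)[OF b] incidence_star[OF b assms(7)] in auto)
qed

text \<open>Four times a number is determined modulo 8 by the parity of that number, and here the
  term \<open>2 ^ card K\<close> cancels in the parity.\<close>

lemma point_count_three_crossing:
  assumes "card R \<ge> 2" and "ends G i = {c, w}" and "star G v w = {i, a, b}"
    and "i \<noteq> a" and "i \<noteq> b" and "a \<noteq> b" and "ends G a \<noteq> {w}" and "ends G b \<noteq> {w}"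
  shows "point_count TYPE(bit) (delete_vertex G v) mod 8 = (if crossing A K R a b = 1 then 4 else 0)"
proof -
  let ?n = "card {x \<in> K \<rightarrow>\<^sub>E UNIV. cpoly K (\<lambda>T. perm2 A T R) x = 0 \<and>
    cpoly K (\<lambda>T. perm2 A (insert a T) R) x = 0 \<and> cpoly K (\<lambda>T. perm2 A (insert b T) R) x = 0}"
  have "a \<notin> K" "b \<notin> K"
    using assms(3) star_disjoint(1) by auto
  then have "(of_nat (2 ^ card K + ?n) :: bit) = crossing A K R a b"
    using parity_common_zeros[of K R a b A] assms by simp
  then have "even (2 ^ card K + ?n) \<longleftrightarrow> crossing A K R a b \<noteq> 1"
    unfolding bit_of_nat_eq_0_iff[symmetric] bit_not_one_iff by (simp only:)
  moreover have "4 * n mod 8 = (if even n then 0 else 4)" for n :: nat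
    by presburger
  ultimately show ?thesis
    unfolding point_count_three[OF assms(2-8)] by (simp only: if_not_P split: if_split) blast
qed

end

section \<open>Comparison of the two deletions\<close>

text \<open>On the rows \<open>R\<close> the columns \<open>a\<close> and \<open>b\<close> add up to
  the sum of all columns of \<open>E\<close>, so the two sides add up to the sum in
  \<open>sum_tree_forest_columns\<close>.\<close>

lemma sum_tree_forest_eq:
  assumes "finite E" and "finite R" and "card R \<ge> 2" and "a \<notin> E" and "b \<notin> E"
    and rows: "\<And>j. j \<in> R \<Longrightarrow> (\<Sum>e\<in>E. A e j) = A a j + A b j"
  shows "(\<Sum>(T, F)\<in>disjoint_pairs E. perm2 A T R * perm2 A (insert a F) R) =
    (\<Sum>(T, F)\<in>disjoint_pairs E. perm2 A T R * perm2 A (insert b F) R)"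
proof -
  have "(\<Sum>(T, F)\<in>disjoint_pairs E. perm2 A T R * perm2 A (insert a F) R) +
      (\<Sum>(T, F)\<in>disjoint_pairs E. perm2 A T R * perm2 A (insert b F) R) =
      (\<Sum>(T, F)\<in>disjoint_pairs E. perm2 A T R * (\<Sum>e\<in>E. \<Sum>j\<in>R. A e j * perm2 A F (R - {j})))"
    unfolding sum.distrib[symmetric]
  proof (intro sum.cong refl, clarify)
    fix T F assume "(T, F) \<in> disjoint_pairs E"
    then have F: "finite F" "a \<notin> F" "b \<notin> F"
      using assms by (auto simp: disjoint_pairs_def intro: rev_finite_subset)
    have "(\<Sum>e\<in>E. \<Sum>j\<in>R. A e j * perm2 A F (R - {j})) = (\<Sum>j\<in>R. (\<Sum>e\<in>E. A e j) * perm2 A F (R - {j}))"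
      by (subst sum.swap) (simp add: sum_distrib_right)
    also have "\<dots> = perm2 A (insert a F) R + perm2 A (insert b F) R"
      using F assms(2) by (simp add: rows perm2_column distrib_right sum.distrib)
    finally show "perm2 A T R * perm2 A (insert a F) R + perm2 A T R * perm2 A (insert b F) R =
        perm2 A T R * (\<Sum>e\<in>E. \<Sum>j\<in>R. A e j * perm2 A F (R - {j}))"
      by (simp add: distrib_left)
  qed
  also have "\<dots> = 0"
    using assms(1-3) by (rule sum_tree_forest_columns)
  finally show ?thesis
    by (simp flip: bit_eq_iff_add_eq_0)
qed


context triangle
begin

interpretation s: triangle G w v c
  by (rule triangle_commute)

lemma R_commute: "verts G - {w, v, c} = R"
  by (simp only: insert_commute)

text \<open>The counts with \<open>v\<close> and \<open>w\<close> exchanged, stated for the same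
  \<open>K\<close> and \<open>R\<close>.\<close>

lemmas point_count_sym =
  s.point_count_one[unfolded core_commute[of G w v] R_commute]
  s.point_count_two[unfolded core_commute[of G w v] R_commute]
  s.point_count_loop[unfolded core_commute[of G w v] R_commute]
  s.point_count_three_crossing[unfolded core_commute[of G w v] R_commute]

lemmas few_odd_sym = s.few_odd[unfolded core_commute[of G w v] R_commute]

text \<open>On \<open>R\<close> the edges at \<open>v\<close> have zero columns, so \<open>a\<close>
  and \<open>b\<close> alone balance \<open>K\<close> and \<open>crossing_eq_0\<close> applies. When
  \<open>w\<close> is deleted, the count is twice the sum of \<open>2 ^ card K\<close> and
  \<open>zeros\<close>, both multiples of four.\<close>

lemma point_count_three_loop:
  assumes R: "card R \<ge> 2" and i: "ends G i = {c, w}" and S: "star G v w = {i, a, b}"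
    and ne: "i \<noteq> a" "i \<noteq> b" "a \<noteq> b" "ends G a \<noteq> {w}" "ends G b \<noteq> {w}"
    and j: "ends G j = {c, v}" and S': "star G w v = {j, l}" and l: "j \<noteq> l" "ends G l = {v}"
  shows "point_count TYPE(bit) (delete_vertex G v) mod 8 = 0"
    and "point_count TYPE(bit) (delete_vertex G w) mod 8 = 0"
proof -
  have mem: "i \<in> star G v w" "a \<in> star G v w" "b \<in> star G v w" and c: "c \<in> ends G i"
    using S i by auto
  have aK: "a \<notin> K" "b \<notin> K"
    using mem star_disjoint(1) by auto
  have zero: "A i r = 0" "A j r = 0" "A l r = 0" if "r \<in> R" for r
    using that i j l by (auto simp: incidence_def)
  have "crossing A K R a b = 0"
  proof (rule few_odd_columns.crossing_eq_0[OF few_odd(1)[OF R] aK])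
    show "(\<Sum>r\<in>R. A e r) = 1" if "card {e \<in> K. (\<Sum>r\<in>R. A e r) = 1} = 2" "e \<in> {a, b}" for e
      using that(2) few_odd(2)[OF R _ _ _ mem(1) c that(1), of e] mem ne by blast
    show "(\<Sum>e\<in>K. A e r) = A a r + A b r" if "r \<in> R" for r
      using zero[OF that] ne l by (simp add: incidence_sum_core[OF that] S S')
  qed
  then show "point_count TYPE(bit) (delete_vertex G v) mod 8 = 0"
    unfolding point_count_three_crossing[OF R i S ne] by simp
  have "card K \<ge> 2"
  proof (rule card_core_ge_2[OF R])
    show "ends G e \<inter> R = {}" if "e \<in> star G w v" for e
      using that j l by (auto simp: S')
    have "{e \<in> star G v w. ends G e \<inter> R \<noteq> {}} \<subseteq> {a, b}"
      using i by (auto simp: S)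
    then have "card {e \<in> star G v w. ends G e \<inter> R \<noteq> {}} \<le> card {a, b}"
      by (intro card_mono) auto
    also have "\<dots> \<le> 2"
      by (simp add: card_insert_if)
    finally show "card {e \<in> star G v w. ends G e \<inter> R \<noteq> {}} \<le> 2" .
  qed
  then have "4 dvd zeros" and "4 dvd (2 :: nat) ^ card K"
    using parity_zeros_even_columns[OF few_odd(1)[OF R]] le_imp_power_dvd[of 2 "card K" "2 :: nat"] by simp_all
  then have "4 dvd 2 ^ card K + zeros"
    by (rule dvd_add[rotated])
  moreover have "2 * n mod 8 = 0" if "4 dvd n" for n :: nat
    using that by presburger
  ultimately show "point_count TYPE(bit) (delete_vertex G w) mod 8 = 0"
    unfolding point_count_sym(3)[OF j S' l] by blast
qed

lemmas point_count_three_loop_sym =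
  triangle.point_count_three_loop[OF triangle_commute, unfolded core_commute[of G w v] R_commute]

text \<open>The counts differ only by four times the difference of two numbers of common zeros,
  which have the same parity by \<open>sum_tree_forest_eq\<close>.\<close>

lemma point_count_two_two:
  assumes R: "card R \<ge> 2" and i: "ends G i = {c, w}" and S: "star G v w = {i, a}" "i \<noteq> a" "ends G a \<noteq> {w}"
    and j: "ends G j = {c, v}" and S': "star G w v = {j, b}" "j \<noteq> b" "ends G b \<noteq> {v}"
  shows "point_count TYPE(bit) (delete_vertex G v) mod 8 = point_count TYPE(bit) (delete_vertex G w) mod 8"
proof -
  let ?n = "\<lambda>a. card {x \<in> K \<rightarrow>\<^sub>E UNIV. cpoly K (\<lambda>T. perm2 A T R) x = 0 \<and> cpoly K (\<lambda>T. perm2 A (insert a T) R) x = 0}"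
  have aK: "a \<notin> K" "b \<notin> K"
    using S(1) S'(1) star_disjoint by auto
  have zero: "A i r = 0" "A j r = 0" if "r \<in> R" for r
    using that i j by (auto simp: incidence_def)
  have "(\<Sum>(T, F)\<in>disjoint_pairs K. perm2 A T R * perm2 A (insert a F) R) =
      (\<Sum>(T, F)\<in>disjoint_pairs K. perm2 A T R * perm2 A (insert b F) R)"
  proof (rule sum_tree_forest_eq)
    show "(\<Sum>e\<in>K. A e r) = A a r + A b r" if "r \<in> R" for r
      using zero[OF that] S(2) S'(2) by (simp add: incidence_sum_core[OF that] S(1) S'(1))
  qed (use R aK in simp_all)
  moreover have "perm2 A T R = 0" if "finite T" "card T \<le> 1" for T
    using that R by (intro perm2_card_neq) auto
  then have "perm2 A {} R = 0" "perm2 A {a} R = 0" "perm2 A {b} R = 0"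
    by simp_all
  ultimately have "(of_nat (?n a) :: bit) = of_nat (?n b)"
    by (simp only: parity_common_zeros2[OF fin(3)])
  moreover have "p mod 8 = q mod 8"
    if "(of_nat n :: bit) = of_nat m" and "p + z = y + 4 * n" "q + z = y + 4 * m" for p q z y n m :: nat
  proof -
    have "(of_nat (n + m) :: bit) = 0"
      using that(1) by simp
    then have "even (n + m)"
      by (simp only: bit_of_nat_eq_0_iff)
    then obtain k where "n + m = 2 * k" ..
    then have "p + 8 * m = q + 8 * k"
      using that(2,3) by linarith
    then show ?thesis
      by (metis mod_mult_self2)
  qed
  ultimately show ?thesis
    using point_count_two[OF i S] point_count_sym(2)[OF j S'] by blast
qed

text \<open>The columns \<open>i\<close> and \<open>j\<close> vanish on \<open>R\<close>, so the
  evenness of the degrees supplies the row condition for \<open>a\<close>, \<open>b\<close>,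
  \<open>p\<close>, \<open>q\<close> in \<open>crossing_eq\<close>.\<close>

lemma point_count_three_three:
  assumes R: "card R \<ge> 2" and i: "ends G i = {c, w}" and S: "star G v w = {i, a, b}"
    and ne: "i \<noteq> a" "i \<noteq> b" "a \<noteq> b" "ends G a \<noteq> {w}" "ends G b \<noteq> {w}"
    and j: "ends G j = {c, v}" and S': "star G w v = {j, p, q}"
    and ne': "j \<noteq> p" "j \<noteq> q" "p \<noteq> q" "ends G p \<noteq> {v}" "ends G q \<noteq> {v}"
  shows "point_count TYPE(bit) (delete_vertex G v) mod 8 = point_count TYPE(bit) (delete_vertex G w) mod 8"
proof -
  have mem: "i \<in> star G v w" "a \<in> star G v w" "b \<in> star G v w" "j \<in> star G w v" "p \<in> star G w v" "q \<in> star G w v"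
    and c: "c \<in> ends G i" "c \<in> ends G j"
    using S S' i j by auto
  have aK: "a \<notin> K" "b \<notin> K" "p \<notin> K" "q \<notin> K"
    using mem star_disjoint by auto
  have zero: "A i r = 0" "A j r = 0" if "r \<in> R" for r
    using that i j by (auto simp: incidence_def)
  have "crossing A K R a b = crossing A K R p q"
  proof (rule few_odd_columns.crossing_eq[OF few_odd(1)[OF R] aK])
    show "(\<Sum>r\<in>R. A e r) = 1" if "card {e \<in> K. (\<Sum>r\<in>R. A e r) = 1} = 2" "e \<in> {a, b, p, q}" for e
      using that(2) few_odd(2)[OF R _ _ _ mem(1) c(1) that(1), of e]
        few_odd_sym(2)[OF R _ _ _ mem(4) c(2) that(1), of e] mem ne ne' by blast
    show "(\<Sum>e\<in>K. A e r) = A a r + A b r + A p r + A q r" if "r \<in> R" for r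
      using zero[OF that] ne ne' by (simp add: incidence_sum_core[OF that] S S' add.assoc)
  qed
  then show ?thesis
    unfolding point_count_three_crossing[OF R i S ne] point_count_sym(4)[OF R j S' ne'] by simp
qed

text \<open>The common multiplicity of the edge between \<open>v\<close> and \<open>w\<close> leaves
  only equal cases at both vertices and the mixture of three edges with a self-loop.\<close>

lemma point_count_mod_8:
  assumes R: "card R \<ge> 2"
  shows "point_count TYPE(bit) (delete_vertex G v) mod 8 = point_count TYPE(bit) (delete_vertex G w) mod 8"
proof (cases rule: star_cases)
  case (one i)
  note l = one
  show ?thesis
  proof (cases rule: s.star_cases)
    case (one j)
    show ?thesis
      by (simp only: point_count_one[OF l(1,2)] point_count_sym(1)[OF one(1,2)])
  qed (use l(3) in \<open>simp_all add: between_commute[of G w v]\<close>)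
next
  case (two i a)
  note l = two
  show ?thesis
  proof (cases rule: s.star_cases)
    case (two j b)
    show ?thesis
      by (rule point_count_two_two[OF R l(1-4) two(1-4)])
  qed (use l(5) in \<open>simp_all add: between_commute[of G w v]\<close>)
next
  case (three i a b)
  note l = three
  show ?thesis
  proof (cases rule: s.star_cases)
    case (three j p q)
    show ?thesis
      by (rule point_count_three_three[OF R l(1-7) three(1-7)])
  next
    case (loop j k)
    show ?thesis
      by (simp only: point_count_three_loop[OF R l(1-7) loop(1-4)])
  qed (use l(8) in \<open>simp_all add: between_commute[of G w v]\<close>)
next
  case (loop i k)
  note l = loop
  show ?thesis
  proof (cases rule: s.star_cases)
    case (three j p q)
    show ?thesis
      by (simp only: point_count_three_loop_sym[OF R three(1-7) l(1-4)])
  next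
    case (loop j m)
    show ?thesis
      by (simp only: point_count_loop[OF l(1-4)] point_count_sym(3)[OF loop(1-4)])
  qed (use l(5) in \<open>simp_all add: between_commute[of G w v]\<close>)
qed

end

section \<open>The number of vertices\<close>

lemma degree_sum_between:
  assumes G: "finite_multigraph G" and V: "verts G = insert u X" and "u \<notin> X" and "\<not> has_loop G"
  shows "degree G u = (\<Sum>x\<in>X. card (between G u x))"
proof -
  have X: "finite X"
    using finite_verts[OF G] V by simp
  have L: "{e \<in> edges G. ends G e = {u}} = {}"
    using assms(4) by (auto simp: has_loop_def)
  have "{e \<in> edges G. u \<in> ends G e} = (\<Union>x\<in>X. between G u x)"
  proof (intro subset_antisym subsetI)
    fix e assume e: "e \<in> {e \<in> edges G. u \<in> ends G e}"
    obtain a b where ab: "ends G e = {a, b}" "a \<in> verts G" "b \<in> verts G"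
      using edge_cases[OF G, of e] e by blast
    have "a \<noteq> b"
      using ab(1) e assms(4) by (auto simp: has_loop_def)
    then obtain x where "x \<in> X" "ends G e = {u, x}"
      using ab e V by (metis (no_types, lifting) insert_commute insert_iff mem_Collect_eq singletonD)
    then show "e \<in> (\<Union>x\<in>X. between G u x)"
      using e by (auto simp: between_def)
  qed (auto simp: between_def)
  moreover have "card (\<Union>x\<in>X. between G u x) = (\<Sum>x\<in>X. card (between G u x))"
    using finite_edges[OF G] assms(3) X
    by (intro card_UN_disjoint) (auto simp: between_def doubleton_eq_iff)
  ultimately show ?thesis
    by (simp only: degree_def L) simp
qed

text \<open>If a fourth vertex \<open>z\<close> is not joined to \<open>w\<close>, then \<open>deg v + deg c = deg w + deg z\<close> leaves
  no edge between \<open>v\<close> and \<open>c\<close>.\<close>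

lemma (in triangle) card_verts_ge_5:
  assumes only: "\<And>u. u \<in> verts G \<Longrightarrow> u \<noteq> v \<Longrightarrow> u \<noteq> w \<Longrightarrow> adjacent G u v \<Longrightarrow> adjacent G u w \<Longrightarrow> u = c"
    and card: "card (verts G) \<ge> 4" and loop: "has_loop G \<Longrightarrow> card (verts G) \<ge> 5"
  shows "card (verts G) \<ge> 5"
proof (rule ccontr)
  assume "\<not> card (verts G) \<ge> 5"
  then have 4: "card (verts G) = 4" and nl: "\<not> has_loop G"
    using card loop by auto
  have "card (verts G - {v, w, c}) = 1"
    using 4 verts neq by (subst card_Diff_subset) auto
  then obtain z where z: "verts G - {v, w, c} = {z}"
    by (auto simp: card_1_singleton_iff)
  then have V: "verts G = {v, w, c, z}" and zne: "z \<noteq> v" "z \<noteq> w" "z \<noteq> c"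
    using verts by auto
  let ?b = "\<lambda>x y. card (between G x y)"
  have deg: "degree G u = 4" if "u \<in> verts G" for u
    using that regular by (simp add: regular_def)
  have sum: "?b u x + ?b u y + ?b u t = 4"
    if "{v, w, c, z} = {u, x, y, t}" "u \<notin> {x, y, t}" "x \<noteq> y" "x \<noteq> t" "y \<noteq> t" for u x y t
    using degree_sum_between[OF G V[unfolded that(1)] that(2) nl] deg[of u] V that by simp
  have "?b v w + ?b v c + ?b v z = 4"
    by (rule sum) (use neq zne in auto)
  moreover have "?b w v + ?b w c + ?b w z = 4"
    by (rule sum) (use neq zne in auto)
  moreover have "?b c v + ?b c w + ?b c z = 4"
    by (rule sum) (use neq zne in auto)
  moreover have "?b z v + ?b z w + ?b z c = 4"
    by (rule sum) (use neq zne in auto)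
  moreover have pos: "?b x y > 0 \<longleftrightarrow> adjacent G x y" for x y
    using finite_edges[OF G] by (auto simp: between_def card_gt_0_iff adjacent_def)
  moreover have "\<not> (adjacent G z v \<and> adjacent G z w)"
    using only[of z] V zne by auto
  moreover have "?b w v = ?b v w" "?b v c = ?b c v" "?b w c = ?b c w" "?b z v = ?b v z" "?b z w = ?b w z" "?b z c = ?b c z"
    by (simp_all only: between_commute[of G])
  moreover have "?b v w > 0" "?b c v > 0" "?b c w > 0"
    using adj by (simp_all only: pos)
  \<comment> \<open>If instead \<open>z\<close> is not joined to \<open>v\<close>, the mirrored
    degree equation leaves no edge between \<open>w\<close> and \<open>c\<close>.\<close>
  moreover have "?b z v = 0 \<or> ?b z w = 0"
    using \<open>\<not> (adjacent G z v \<and> adjacent G z w)\<close> unfolding pos[symmetric] by linarith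
  ultimately show False
    by linarith
qed

theorem mainTheorem2:
  fixes G :: "('v, 'e) multigraph" and v w :: 'v
  assumes "finite_multigraph G"
    and "connected_graph G"
    and "regular 4 G"
    and "v \<in> verts G" and "w \<in> verts G"
    and "adjacent G v w"
    and "card {u \<in> verts G. u \<noteq> v \<and> u \<noteq> w \<and> adjacent G u v \<and> adjacent G u w} = 1"
    and "card (verts G) \<ge> 4"
    and "has_loop G \<Longrightarrow> card (verts G) \<ge> 5"
  shows "c2 TYPE(bit) (delete_vertex G v) = c2 TYPE(bit) (delete_vertex G w)"
proof (cases "v = w")
  case False
  obtain c where c: "{u \<in> verts G. u \<noteq> v \<and> u \<noteq> w \<and> adjacent G u v \<and> adjacent G u w} = {c}"
    using assms(7) by (auto simp: card_1_singleton_iff)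
  have "c \<in> {u \<in> verts G. u \<noteq> v \<and> u \<noteq> w \<and> adjacent G u v \<and> adjacent G u w}"
    unfolding c by simp
  then have "c \<in> verts G" "c \<noteq> v" "c \<noteq> w" "adjacent G c v" "adjacent G c w"
    by simp_all
  then interpret triangle G v w c
    by (intro triangle.intro assms(1,3-6) False)
  have "card (verts G) \<ge> 5"
  proof (rule card_verts_ge_5[OF _ assms(8,9)])
    fix u assume "u \<in> verts G" "u \<noteq> v" "u \<noteq> w" "adjacent G u v" "adjacent G u w"
    then have "u \<in> {u \<in> verts G. u \<noteq> v \<and> u \<noteq> w \<and> adjacent G u v \<and> adjacent G u w}"
      by simp
    then show "u = c"
      unfolding c by simp
  qed
  then have "card R \<ge> 2"
    using verts neq by (subst card_Diff_subset) auto
  then have "point_count TYPE(bit) (delete_vertex G v) mod 8 = point_count TYPE(bit) (delete_vertex G w) mod 8"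
    by (rule point_count_mod_8)
  \<comment> \<open>The quotient by four modulo two is a binary digit of the count, so the residue
    modulo 8 determines it.\<close>
  moreover have "n div 2\<^sup>2 mod 2 = n mod 8 div 4" for n :: nat
    using div_mult2_eq[of n 4 2] mod_mult2_eq[of n 4 2] by simp
  ultimately show ?thesis
    unfolding c2_def card_bit by (simp only:)
qed simp

end
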